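(* Let $n\ge 1$ be an integer and $s\in(0,1)$. Let $R:[0,\infty)\to\mathbb{R}$ be continuous and strictly decreasing with $R(r)>0$ for all $r\ge 0$. Let $f:[0,\infty)\to\mathbb{R}$ be locally Lipschitz on $[0,\infty)$ with $f>0$ on $[0,\infty)$, such that $f\in C^1([0,\delta])$ for some $\delta>0$ and $$f'(0)<-\sigma\quad\text{for some constant }\sigma>0.$$ Let $u\in C^{2s+\varepsilon,\,s+\varepsilon/2}_{x,t,\mathrm{loc}}(\mathbb{R}^n\times\mathbb{R})\cap\mathcal{L}(\mathbb{R}^n\times\mathbb{R})$, for some $\varepsilon>0$, be a positive bounded classical solution of $$(\partial_t-\Delta)^s u(x,t)=R(|x|)\,f(u(x,t))\quad\text{for all }(x,t)\in\mathbb{R}^n\times\mathbb{R}.$$ Assume that $u$ is uniformly continuous on $\mathbb{R}^n\times\mathbb{R}$ and that $$\lim_{|x|\to+\infty}u(x,t)=0\quad\text{uniformly in }t\in\mathbb{R}.$$ Then for each $t\in\mathbb{R}$ the function $u(\cdot,t)$ is radially symmetric and strictly radially decreasing with respect to the origin, i.e. $u(x,t)=u(y,t)$ whenever $|x|=|y|$ and $u(x,t)>u(y,t)$ whenever $|x|<|y|$. Equivalently, for each $t\in\mathbb{R}$ and any unit vector $e\in\mathbb{R}^n$, $u(\cdot,t)$ is symmetric about the hyperplane $\{x\cdot e=0\}$ and strictly decreasing along rays emanating from the origin.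
   Context: **Master operator (fully fractional heat operator).** For $0<s<1$, $$(\partial_t-\Delta)^s u(x,t):=C_{n,s}\int_{-\infty}^{t}\int_{\mathbb{R}^n}\frac{u(x,t)-u(y,\tau)}{(t-\tau)^{\frac n2+1+s}}\,e^{-\frac{|x-y|^2}{4(t-\tau)}}\,dy\,d\tau,\qquad C_{n,s}=\frac{1}{(4\pi)^{n/2}|\Gamma(-s)|}.$$ **The space $\mathcal{L}(\mathbb{R}^n\times\mathbb{R})$** (slowly increasing functions) is the set of $u\in L^1_{\mathrm{loc}}(\mathbb{R}^n\times\mathbb{R})$ such that $$\int_{-\infty}^{t}\int_{\mathbb{R}^n}\frac{|u(x,\tau)|\,e^{-\frac{|x|^2}{4(t-\tau)}}}{1+(t-\tau)^{\frac n2+1+s}}\,dx\,d\tau<\infty\quad\text{for every }t\in\mathbb{R}.$$ **Local parabolic Hölder spaces.** For $\alpha>0$, $u\in C^{2\alpha,\alpha}_{x,t,\mathrm{loc}}(\mathbb{R}^n\times\mathbb{R})$ means that on every compact set the following holds for some constant $C$ (depending on the compact set): - if $0<2\alpha\le 1$: $|u(x,t)-u(y,\tau)|\le C\,(|x-y|+|t-\tau|^{1/2})^{2\alpha}$; - if $1<2\alpha\le 2$: $u$ is differentiable in $x$, $|\nabla_x u(x,t)-\nabla_x u(y,\tau)|\le C\,(|x-y|+|t-\tau|^{1/2})^{2\alpha-1}$, and $|u(x,t)-u(x,\tau)|\le C|t-\tau|^{\alpha}$; - if $2\alpha>2$: $\partial_t u$ and $D_x^2u$ exist and belong to $C^{2\alpha-2,\alpha-1}_{x,t,\mathrm{loc}}$.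 Here the space is used with $2\alpha=2s+\varepsilon$. **Classical solution** means a function $u\in\mathcal{L}(\mathbb{R}^n\times\mathbb{R})\cap C^{2s+\varepsilon,s+\varepsilon/2}_{x,t,\mathrm{loc}}(\mathbb{R}^n\times\mathbb{R})$ for some $\varepsilon>0$ satisfying the equation pointwise at every $(x,t)\in\mathbb{R}^n\times\mathbb{R}$. "Positive" means $u>0$ everywhere. $f'(0)$ denotes the one-sided (right) derivative of $f$ at $0$. *)

theory Defs
  imports "HOL-Analysis.Analysis"
begin

text \<open>
  Functions on $\mathbb{R}^n \times \mathbb{R}$ are curried, \<open>u x t\<close> with \<open>x :: real ^ 'n\<close>
  and \<open>t :: real\<close>; the dimension is \<open>n = CARD('n)\<close>.
\<close>

definition frac_heat_const :: "nat \<Rightarrow> real \<Rightarrow> real" where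
  "frac_heat_const n s = 1 / ((4 * pi) powr (real n / 2) * \<bar>Gamma (- s)\<bar>)"

text \<open>
  The integral is iterated, space first. For \<open>s \<ge> 1/2\<close> the integrand is in general not
  absolutely integrable in \<open>(y, \<tau>)\<close> jointly near \<open>(x, t)\<close>: the first-order term in \<open>y - x\<close>
  cancels only after the integration over \<open>y\<close>.
\<close>

definition frac_heat :: "real \<Rightarrow> (real ^ 'n \<Rightarrow> real \<Rightarrow> real) \<Rightarrow> real ^ 'n \<Rightarrow> real \<Rightarrow> real" where
  "frac_heat s u x t =
     frac_heat_const CARD('n) s *
     (LINT \<tau>:{..<t}|lebesgue. (LINT y|lebesgue.
        (u x t - u y \<tau>) / (t - \<tau>) powr (real CARD('n) / 2 + 1 + s)
          * exp (- (norm (x - y))\<^sup>2 / (4 * (t - \<tau>)))))"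

definition slowly_increasing :: "real \<Rightarrow> (real ^ 'n \<Rightarrow> real \<Rightarrow> real) \<Rightarrow> bool" where
  "slowly_increasing s u \<longleftrightarrow>
     (\<forall>K. compact K \<longrightarrow> set_integrable lebesgue K (\<lambda>(x, t). u x t)) \<and>
     (\<forall>t. (\<integral>\<^sup>+\<tau>\<in>{..<t}. (\<integral>\<^sup>+x. ennreal
              (\<bar>u x \<tau>\<bar> * exp (- (norm x)\<^sup>2 / (4 * (t - \<tau>)))
                / (1 + (t - \<tau>) powr (real CARD('n) / 2 + 1 + s))) \<partial>lebesgue) \<partial>lebesgue) < \<infinity>)"

text \<open>
  \<open>parabolic_holder_loc a u\<close> is $u \in C^{a,a/2}_{x,t,\mathrm{loc}}$, so \<open>a\<close> is the exponent
  $2\alpha$. A matrix-valued function is in the class iff all its entries are.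
\<close>

inductive parabolic_holder_loc :: "real \<Rightarrow> (real ^ 'n \<Rightarrow> real \<Rightarrow> real) \<Rightarrow> bool" where
  low:
    "\<lbrakk>0 < a; a \<le> 1;
      \<forall>K. compact K \<longrightarrow> (\<exists>C. \<forall>(x, t)\<in>K. \<forall>(y, \<tau>)\<in>K.
        \<bar>u x t - u y \<tau>\<bar> \<le> C * (norm (x - y) + sqrt \<bar>t - \<tau>\<bar>) powr a)\<rbrakk>
     \<Longrightarrow> parabolic_holder_loc a u"
| middle:
    "\<lbrakk>1 < a; a \<le> 2;
      \<forall>x t. GDERIV (\<lambda>z. u z t) x :> g x t;
      \<forall>K. compact K \<longrightarrow> (\<exists>C. \<forall>(x, t)\<in>K. \<forall>(y, \<tau>)\<in>K.
        norm (g x t - g y \<tau>) \<le> C * (norm (x - y) + sqrt \<bar>t - \<tau>\<bar>) powr (a - 1));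
      \<forall>K. compact K \<longrightarrow> (\<exists>C. \<forall>x t \<tau>. (x, t) \<in> K \<longrightarrow> (x, \<tau>) \<in> K \<longrightarrow>
        \<bar>u x t - u x \<tau>\<bar> \<le> C * \<bar>t - \<tau>\<bar> powr (a / 2))\<rbrakk>
     \<Longrightarrow> parabolic_holder_loc a u"
| high:
    "\<lbrakk>2 < a;
      \<forall>x t. ((\<lambda>\<tau>. u x \<tau>) has_real_derivative v x t) (at t);
      \<forall>x t. GDERIV (\<lambda>z. u z t) x :> g x t;
      \<forall>x t. ((\<lambda>z. g z t) has_derivative (\<lambda>h. H x t *v h)) (at x);
      parabolic_holder_loc (a - 2) v;
      \<forall>i j. parabolic_holder_loc (a - 2) (\<lambda>x t. H x t $ i $ j)\<rbrakk>
     \<Longrightarrow> parabolic_holder_loc a u"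

definition classical_solution ::
  "real \<Rightarrow> (real ^ 'n \<Rightarrow> real \<Rightarrow> real) \<Rightarrow> (real ^ 'n \<Rightarrow> real \<Rightarrow> real) \<Rightarrow> bool" where
  "classical_solution s u F \<longleftrightarrow>
     slowly_increasing s u \<and>
     (\<exists>\<epsilon>>0. parabolic_holder_loc (2 * s + \<epsilon>) u) \<and>
     (\<forall>x t. frac_heat s u x t = F x t)"

end

theory Submission
  imports Defs "HOL-Probability.Distributions"
begin

text \<open>
  The proof uses moving planes, but only through a quantitative maximum principle. Let \<open>w\<close> be
  the difference between the reflection of \<open>u\<close> in the plane \<open>{x. x \<bullet> e = l}\<close>, \<open>l < 0\<close>, and
  \<open>u\<close> itself. It is antisymmetric, so its heat extension on \<open>{x. x \<bullet> e < l}\<close> is an integral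
  against the difference of the Gaussian and its reflection, and if \<open>w\<close> has a negative minimum
  \<open>- m\<close> at distance \<open>d\<close> from the plane then the operator applied to \<open>w\<close> is at most
  \<open>- k * m * d powr (- 2 * s)\<close> there. On the other side, the equation bounds it below: far from
  the origin by 0, because \<open>f\<close> is decreasing near 0; elsewhere by a Lipschitz multiple of
  \<open>- m\<close> plus the gain from \<open>R\<close> being strictly decreasing. Hence \<open>d\<close> is bounded below and then
  so is \<open>m\<close>: for \<open>l\<close> bounded away from 0, either \<open>w \<ge> 0\<close> or \<open>inf w\<close> is below a fixed negative
  constant. Since \<open>w\<close> depends uniformly continuously on \<open>l\<close> and \<open>u\<close> decays, \<open>w \<ge> 0\<close>
  propagates from \<open>l = - \<infinity>\<close> to every \<open>l < 0\<close>. Any two points with \<open>norm x < norm y\<close> are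
  exchanged by such a reflection, and symmetry follows by continuity.
\<close>

subsection \<open>Invariance of Lebesgue measure under reflections\<close>

lemma nn_integral_lborel_affine:
  fixes g :: "'a::euclidean_space \<Rightarrow> ennreal"
  assumes [measurable]: "g \<in> borel_measurable borel" and c: "\<bar>c\<bar> = 1"
  shows "(\<integral>\<^sup>+x. g (t + c *\<^sub>R x) \<partial>lborel) = (\<integral>\<^sup>+x. g x \<partial>lborel)"
proof -
  have "c \<noteq> 0" using c by auto
  have "(\<integral>\<^sup>+x. g x \<partial>lborel) =
      (\<integral>\<^sup>+x. g x \<partial>density (distr lborel borel (\<lambda>x. t + c *\<^sub>R x)) (\<lambda>_. \<bar>c\<bar> ^ DIM('a)))"
    using lborel_affine[OF \<open>c \<noteq> 0\<close>, of t] by simp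
  also have "\<dots> = (\<integral>\<^sup>+x. g (t + c *\<^sub>R x) \<partial>lborel)"
    by (simp add: nn_integral_density nn_integral_distr c)
  finally show ?thesis by simp
qed

text \<open>
  Uniqueness of Haar measure: both sides, multiplied by the volume of the unit ball, equal
  the double integral of \<open>g x * indicator (ball 0 1) (f y - x)\<close>.
\<close>

lemma nn_integral_lborel_orthogonal:
  fixes f :: "'a::euclidean_space \<Rightarrow> 'a" and g :: "'a \<Rightarrow> ennreal"
  assumes f: "orthogonal_transformation f" and [measurable]: "g \<in> borel_measurable borel"
  shows "(\<integral>\<^sup>+x. g (f x) \<partial>lborel) = (\<integral>\<^sup>+x. g x \<partial>lborel)"
proof -
  have lin: "linear f" by (simp add: f orthogonal_transformation_linear)
  then have [measurable]: "f \<in> borel_measurable borel"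
    by (intro borel_measurable_continuous_onI linear_continuous_on linear_conv_bounded_linear[THEN iffD1])
  define b where "b = (indicator (ball 0 1) :: 'a \<Rightarrow> ennreal)"
  have [measurable]: "b \<in> borel_measurable borel"
    unfolding b_def by (intro borel_measurable_indicator) simp
  define V where "V = (\<integral>\<^sup>+x. b x \<partial>lborel)"
  have V: "V = emeasure lborel (ball (0::'a) 1)" by (simp add: V_def b_def)
  have V0: "V \<noteq> 0"
    using content_ball_pos[of 1 "0::'a"] by (auto simp: V measure_def)
  have Vinf: "V \<noteq> \<infinity>" using emeasure_lborel_ball_finite[of "0::'a" 1] by (simp add: V)
  \<comment> \<open>By surjectivity \<open>x = f z\<close>, so subtracting \<open>x\<close> after
    \<open>f\<close> amounts to translating by \<open>- z\<close> before \<open>f\<close>.\<close>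
  have trans: "(\<integral>\<^sup>+y. h (f y - x) \<partial>lborel) = (\<integral>\<^sup>+y. h (f y) \<partial>lborel)"
    if [measurable]: "h \<in> borel_measurable borel" for h :: "'a \<Rightarrow> ennreal" and x
  proof -
    obtain z where z: "f z = x"
      using orthogonal_transformation_surj[OF f] by (metis surjD)
    have "(\<integral>\<^sup>+y. h (f y - x) \<partial>lborel) = (\<integral>\<^sup>+y. h (f (- z + 1 *\<^sub>R y)) \<partial>lborel)"
      by (simp add: linear_add[OF lin] linear_neg[OF lin] linear_diff[OF lin] z)
    also have "\<dots> = (\<integral>\<^sup>+y. h (f y) \<partial>lborel)"
      by (rule nn_integral_lborel_affine[where g = "\<lambda>y. h (f y)"]) auto
    finally show ?thesis .
  qed
  have bf: "b (f y) = b y" for y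
    using orthogonal_transformation_norm[OF f] by (simp add: b_def indicator_def)
  have bV: "(\<integral>\<^sup>+y. b (f y - x) \<partial>lborel) = V" for x
    unfolding V_def by (subst trans) (simp_all add: bf)
  have "(\<integral>\<^sup>+x. g x \<partial>lborel) * V = (\<integral>\<^sup>+x. g x * V \<partial>lborel)"
    by (simp add: nn_integral_multc)
  also have "\<dots> = (\<integral>\<^sup>+x. (\<integral>\<^sup>+y. g x * b (f y - x) \<partial>lborel) \<partial>lborel)"
  proof (rule nn_integral_cong)
    fix x
    have "(\<lambda>y. b (f y - x)) \<in> borel_measurable lborel" by measurable
    then show "g x * V = (\<integral>\<^sup>+y. g x * b (f y - x) \<partial>lborel)"
      by (simp only: nn_integral_cmult bV)
  qed
  also have "\<dots> = (\<integral>\<^sup>+y. (\<integral>\<^sup>+x. g x * b (f y - x) \<partial>lborel) \<partial>lborel)"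
    by (rule lborel_pair.Fubini'[symmetric]) simp
  \<comment> \<open>For fixed \<open>y\<close>, \<open>x\<close> is replaced by
    \<open>f y - x\<close>. This frees \<open>b\<close> from \<open>f\<close>, and after exchanging
    the integrals \<open>trans\<close> removes the shift from \<open>g\<close>.\<close>
  also have "\<dots> = (\<integral>\<^sup>+y. (\<integral>\<^sup>+x. g (f y - x) * b x \<partial>lborel) \<partial>lborel)"
  proof (rule nn_integral_cong)
    fix y
    show "(\<integral>\<^sup>+x. g x * b (f y - x) \<partial>lborel) = (\<integral>\<^sup>+x. g (f y - x) * b x \<partial>lborel)"
      using nn_integral_lborel_affine[where g = "\<lambda>x. g x * b (f y - x)" and t = "f y" and c = "-1"]
      by simp
  qed
  also have "\<dots> = (\<integral>\<^sup>+x. (\<integral>\<^sup>+y. g (f y - x) * b x \<partial>lborel) \<partial>lborel)"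
    by (rule lborel_pair.Fubini') simp
  also have "\<dots> = (\<integral>\<^sup>+y. g (f y) \<partial>lborel) * V"
    by (simp add: nn_integral_cmult nn_integral_multc trans V_def)
  finally show ?thesis
    using V0 Vinf by (simp add: mult.commute[of _ V] ennreal_mult_cancel_left)
qed

definition reflect :: "'a::euclidean_space \<Rightarrow> real \<Rightarrow> 'a \<Rightarrow> 'a" where
  "reflect e l y = y + (2 * (l - y \<bullet> e)) *\<^sub>R e"

lemma continuous_on_reflect [continuous_intros]:
  "continuous_on S g \<Longrightarrow> continuous_on S (\<lambda>x. reflect e l (g x))"
  unfolding reflect_def by (intro continuous_intros)

lemma borel_measurable_reflect [measurable]: "reflect e l \<in> borel_measurable borel"
  by (intro borel_measurable_continuous_onI continuous_intros)

lemma inner_reflect: "norm e = 1 \<Longrightarrow> reflect e l x \<bullet> e = 2 * l - x \<bullet> e"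
  by (simp add: reflect_def inner_add_left dot_square_norm)

lemma reflect_reflect [simp]: "norm e = 1 \<Longrightarrow> reflect e l (reflect e l x) = x"
  by (subst reflect_def, subst inner_reflect) (auto simp: reflect_def algebra_simps)

text \<open>The product term is positive exactly when both points lie strictly on the same side of
  the plane, and then \<open>y\<close> is closer to \<open>x\<close> than its mirror image is. The
  sign of the folded Gaussian kernel and, for \<open>x = 0\<close>, the change of norm under
  reflection both come from this identity.\<close>

lemma norm_diff_reflect_sq:
  assumes "norm e = 1"
  shows "(norm (x - reflect e l y))\<^sup>2 = (norm (x - y))\<^sup>2 + 4 * (l - x \<bullet> e) * (l - y \<bullet> e)"
  using assms unfolding power2_norm_eq_inner reflect_def norm_eq_1
  by (simp add: inner_simps inner_commute algebra_simps power2_eq_square)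

lemma norm_reflect_sq:
  "norm e = 1 \<Longrightarrow> (norm (reflect e l y))\<^sup>2 = (norm y)\<^sup>2 + 4 * l * (l - y \<bullet> e)"
  using norm_diff_reflect_sq[of e 0 l y] by simp

lemma norm_reflect_diff_reflect:
  assumes "norm e = 1"
  shows "norm (reflect e l x - reflect e l y) = norm (x - y)"
proof -
  have "(norm (reflect e l x - reflect e l y))\<^sup>2 = (norm (x - y))\<^sup>2"
    using assms by (simp add: norm_diff_reflect_sq inner_reflect norm_minus_commute[of _ y])
       (simp add: norm_diff_reflect_sq norm_minus_commute algebra_simps)
  then show ?thesis by simp
qed

text \<open>An affine reflection is the linear one, \<open>reflect e 0\<close>, followed by a
  translation along \<open>e\<close>.\<close>

lemma nn_integral_reflect:
  fixes g :: "'a::euclidean_space \<Rightarrow> ennreal"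
  assumes e: "norm e = 1" and [measurable]: "g \<in> borel_measurable borel"
  shows "(\<integral>\<^sup>+x. g (reflect e l x) \<partial>lborel) = (\<integral>\<^sup>+x. g x \<partial>lborel)"
proof -
  have "orthogonal_transformation (reflect e 0)"
    unfolding orthogonal_transformation
  proof
    show "linear (reflect e 0)"
      by (rule linearI) (simp_all add: reflect_def inner_simps algebra_simps)
  qed (use e norm_reflect_sq[of e 0] in simp)
  then have "(\<integral>\<^sup>+x. g ((2 * l) *\<^sub>R e + reflect e 0 x) \<partial>lborel) = (\<integral>\<^sup>+x. g ((2 * l) *\<^sub>R e + 1 *\<^sub>R x) \<partial>lborel)"
    by (subst nn_integral_lborel_orthogonal[where f = "reflect e 0"]) auto
  also have "\<dots> = (\<integral>\<^sup>+x. g x \<partial>lborel)"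
    by (rule nn_integral_lborel_affine) auto
  finally show ?thesis by (simp add: reflect_def algebra_simps)
qed

lemma distr_reflect: "norm e = 1 \<Longrightarrow> distr lborel borel (reflect e l) = lborel"
proof (rule measure_eqI)
  fix A assume e: "norm e = 1" and "A \<in> sets (distr lborel borel (reflect e l))"
  then have [measurable]: "A \<in> sets borel" by simp
  have "emeasure (distr lborel borel (reflect e l)) A = (\<integral>\<^sup>+x. indicator A x \<partial>distr lborel borel (reflect e l))"
    by simp
  also have "\<dots> = (\<integral>\<^sup>+x. indicator A (reflect e l x) \<partial>lborel)"
    by (rule nn_integral_distr) auto
  also have "\<dots> = (\<integral>\<^sup>+x. indicator A x \<partial>lborel)"
    by (rule nn_integral_reflect) (auto simp: e)
  finally show "emeasure (distr lborel borel (reflect e l)) A = emeasure lborel A" by simp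
qed simp

lemma
  fixes g :: "'a::euclidean_space \<Rightarrow> real"
  assumes e: "norm e = 1" and g [measurable]: "g \<in> borel_measurable borel"
  shows integral_reflect: "(\<integral>x. g (reflect e l x) \<partial>lborel) = (\<integral>x. g x \<partial>lborel)"
    and integrable_reflect: "integrable lborel (\<lambda>x. g (reflect e l x)) \<longleftrightarrow> integrable lborel g"
  using integral_distr[of "reflect e l" lborel borel g] integrable_distr_eq[of "reflect e l" lborel borel g]
  by (simp_all add: distr_reflect[OF e])

subsection \<open>The Gaussian kernel\<close>

text \<open>The heat kernel at time \<open>a\<close> without its normalising factor, as it occurs in
  the operator; for \<open>0 < a\<close> its mass is
  \<open>(4 * pi * a) powr (n / 2)\<close>.\<close>

definition gauss :: "real \<Rightarrow> 'a::euclidean_space \<Rightarrow> real" where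
  "gauss a z = exp (- (norm z)\<^sup>2 / (4 * a))"

lemma gauss_nonneg: "0 \<le> gauss a z"
  by (simp add: gauss_def)

lemma borel_measurable_gauss [measurable]: "gauss a \<in> borel_measurable borel"
  unfolding gauss_def by measurable

lemma has_bochner_integral_gauss:
  assumes a: "0 < a"
  shows "has_bochner_integral lborel (gauss a :: 'a::euclidean_space \<Rightarrow> real) ((4 * pi * a) powr (real DIM('a) / 2))"
proof (rule has_bochner_integral_nn_integral)
  let ?g = "\<lambda>x::real. exp (- x\<^sup>2 / (4 * a))"
  \<comment> \<open>Each one-dimensional factor is a multiple of the centred normal density of
    variance \<open>2 * a\<close>.\<close>
  have 1: "?g x = sqrt (4 * pi * a) * normal_density 0 (sqrt (2 * a)) x" for x
    using a by (simp add: normal_density_def mult.assoc mult.commute[of a] mult.left_commute[of a])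
  have "(\<integral>\<^sup>+x. ennreal (?g x) \<partial>lborel) = ennreal (\<integral>x. ?g x \<partial>lborel)"
    unfolding 1 using a by (intro nn_integral_eq_integral) auto
  also have "\<dots> = ennreal (sqrt (4 * pi * a))"
    unfolding 1 using a by simp
  finally have g1: "(\<integral>\<^sup>+x. ennreal (?g x) \<partial>lborel) = ennreal (sqrt (4 * pi * a))" .
  have "gauss a x = (\<Prod>b\<in>Basis. ?g (x \<bullet> b))" for x :: 'a
  proof -
    have "(norm x)\<^sup>2 = (\<Sum>b\<in>Basis. (x \<bullet> b)\<^sup>2)"
      by (simp only: power2_norm_eq_inner euclidean_inner[of x x]) (simp only: power2_eq_square)
    then show ?thesis
      by (simp add: gauss_def exp_sum[symmetric] sum_divide_distrib[symmetric] sum_negf)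
  qed
  then have "(\<integral>\<^sup>+x. ennreal (gauss a x) \<partial>(lborel::'a measure)) = (\<integral>\<^sup>+x. (\<Prod>b\<in>Basis. ennreal (?g (x \<bullet> b))) \<partial>(lborel::'a measure))"
    by (simp add: prod_ennreal)
  also have "\<dots> = (\<Prod>b\<in>(Basis::'a set). \<integral>\<^sup>+x. ennreal (?g x) \<partial>lborel)"
    by (rule nn_integral_lborel_prod) auto
  also have "\<dots> = ennreal (sqrt (4 * pi * a) ^ DIM('a))"
    unfolding g1 using a by (simp add: ennreal_power)
  also have "sqrt (4 * pi * a) ^ DIM('a) = (4 * pi * a) powr (real DIM('a) / 2)"
    using a by (simp add: powr_half_sqrt[symmetric] powr_realpow[symmetric] powr_powr del: powr_half_sqrt)
  finally show "(\<integral>\<^sup>+x. ennreal (gauss a x) \<partial>(lborel::'a measure)) = ennreal ((4 * pi * a) powr (real DIM('a) / 2))" .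
qed (auto simp: gauss_nonneg)

lemma has_bochner_integral_gauss_diff:
  fixes x :: "'a::euclidean_space"
  assumes a: "0 < a"
  shows "has_bochner_integral lborel (\<lambda>y. gauss a (x - y)) ((4 * pi * a) powr (real DIM('a) / 2))"
proof (rule has_bochner_integral_nn_integral)
  have "(\<integral>\<^sup>+y. ennreal (gauss a (x - y)) \<partial>lborel) = (\<integral>\<^sup>+y. ennreal (gauss a y) \<partial>(lborel::'a measure))"
    using nn_integral_lborel_affine[where g = "\<lambda>y. ennreal (gauss a y)" and t = x and c = "-1"] by simp
  also have "\<dots> = ennreal (integral\<^sup>L lborel (gauss a :: 'a \<Rightarrow> real))"
    using has_bochner_integral_gauss[OF a, where 'a = 'a]
    by (intro nn_integral_eq_integral) (auto simp: has_bochner_integral_iff gauss_nonneg)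
  finally show "(\<integral>\<^sup>+y. ennreal (gauss a (x - y)) \<partial>lborel) = ennreal ((4 * pi * a) powr (real DIM('a) / 2))"
    using has_bochner_integral_gauss[OF a, where 'a = 'a] by (simp add: has_bochner_integral_iff)
qed (auto simp: gauss_nonneg)

lemma gauss_reflect: "norm e = 1 \<Longrightarrow> gauss a (reflect e l x - reflect e l y) = gauss a (x - y)"
  by (simp add: gauss_def norm_reflect_diff_reflect)

context
  fixes e :: "'a::euclidean_space" and l a :: real and x :: 'a
  assumes e: "norm e = 1" and a: "0 < a" and x: "x \<bullet> e < l"
begin

lemma integrable_gauss_reflect:
  "integrable lborel (\<lambda>y. gauss a (x - y))" "integrable lborel (\<lambda>y. gauss a (x - reflect e l y))"
  using has_bochner_integral_gauss_diff[OF a, of x] integrable_reflect[OF e, where g = "\<lambda>y. gauss a (x - y)"]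
  by (simp_all add: has_bochner_integral_iff)

lemma integrable_min_gauss:
  "integrable lborel (\<lambda>y. min (gauss a (x - y)) (gauss a (x - reflect e l y)))"
  by (intro integrable_min integrable_gauss_reflect)

text \<open>Folding by the reflection turns twice the integral into \<open>v\<close> against the
  difference of the two Gaussians, which is nonnegative on the side of \<open>x\<close>. There
  \<open>v \<ge> - \<mu>\<close>, and on the other side \<open>v \<le> \<mu>\<close>, so the worst
  case is \<open>- \<mu>\<close> times half the mass of the absolute difference: full mass minus
  overlap.\<close>

lemma integral_antisymmetric_gauss_ge:
  assumes [measurable]: "v \<in> borel_measurable borel" and bdd: "\<And>y. \<bar>v y\<bar> \<le> B"
    and anti: "\<And>y. v (reflect e l y) = - v y"
    and \<mu>: "\<And>y. y \<bullet> e < l \<Longrightarrow> - \<mu> \<le> v y"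
  shows "(\<integral>y. v y * gauss a (x - y) \<partial>lborel) \<ge>
    - \<mu> * ((4 * pi * a) powr (real DIM('a) / 2) -
            (\<integral>y. min (gauss a (x - y)) (gauss a (x - reflect e l y)) \<partial>lborel))"
proof -
  let ?E = "\<lambda>y. gauss a (x - y)" and ?F = "\<lambda>y. gauss a (x - reflect e l y)"
  note int = integrable_gauss_reflect integrable_min_gauss
  have iv: "integrable lborel (\<lambda>y. v y * h y)" if "integrable lborel h" for h :: "'a \<Rightarrow> real"
  proof (rule Bochner_Integration.integrable_bound[OF integrable_mult_right[OF that, of B]])
    show "AE y in lborel. norm (v y * h y) \<le> norm (B * h y)"
      using bdd by (intro AE_I2) (auto simp: abs_mult intro!: mult_right_mono order_trans[OF bdd abs_ge_self])
    show "(\<lambda>y. v y * h y) \<in> borel_measurable lborel"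
      using borel_measurable_integrable[OF that] by simp
  qed
  have "(\<integral>y. v y * ?E y \<partial>lborel) = (\<integral>y. v (reflect e l y) * ?F y \<partial>lborel)"
    by (rule integral_reflect[OF e, where g = "\<lambda>y. v y * ?E y", symmetric]) simp
  then have "2 * (\<integral>y. v y * ?E y \<partial>lborel) = (\<integral>y. v y * (?E y - ?F y) \<partial>lborel)"
    using iv[OF int(1)] iv[OF int(2)] by (simp add: anti right_diff_distrib)
  \<comment> \<open>Sum minus twice the minimum is the absolute difference of the two
    Gaussians.\<close>
  also have "\<dots> \<ge> (\<integral>y. - \<mu> * (?E y + ?F y - 2 * min (?E y) (?F y)) \<partial>lborel)"
  proof (rule integral_mono)
    show "integrable lborel (\<lambda>y. v y * (?E y - ?F y))"
      by (intro iv Bochner_Integration.integrable_diff int)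
    fix y
    have eq: "(norm (x - reflect e l y))\<^sup>2 = (norm (x - y))\<^sup>2 + 4 * (l - x \<bullet> e) * (l - y \<bullet> e)"
      by (rule norm_diff_reflect_sq[OF e])
    consider "y \<bullet> e < l" | "y \<bullet> e = l" | "l < y \<bullet> e" by linarith
    then show "- \<mu> * (?E y + ?F y - 2 * min (?E y) (?F y)) \<le> v y * (?E y - ?F y)"
    proof cases
      case 1
      then have "0 \<le> 4 * (l - x \<bullet> e) * (l - y \<bullet> e)" using x by simp
      then have "?F y \<le> ?E y" using a unfolding gauss_def eq exp_le_cancel_iff
        by (intro divide_right_mono) linarith+
      then show ?thesis using mult_right_mono[OF \<mu>[OF 1], of "?E y - ?F y"] by (simp add: min_def)
    next
      case 2
      then show ?thesis by (simp add: reflect_def)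
    next
      case 3
      then have "4 * (l - x \<bullet> e) * (l - y \<bullet> e) \<le> 0" using x by (simp add: mult_nonneg_nonpos)
      then have "?E y \<le> ?F y" using a unfolding gauss_def eq exp_le_cancel_iff
        by (intro divide_right_mono) linarith+
      moreover have "v y \<le> \<mu>" using \<mu>[of "reflect e l y"] 3 by (simp add: inner_reflect[OF e] anti)
      ultimately show ?thesis using mult_right_mono[of "v y" \<mu> "?F y - ?E y"] by (simp add: min_def algebra_simps)
    qed
  qed (intro integrable_mult_right Bochner_Integration.integrable_diff Bochner_Integration.integrable_add int)
  also have "(\<integral>y. - \<mu> * (?E y + ?F y - 2 * min (?E y) (?F y)) \<partial>lborel) =
      - \<mu> * ((\<integral>y. ?E y \<partial>lborel) + (\<integral>y. ?F y \<partial>lborel) - 2 * (\<integral>y. min (?E y) (?F y) \<partial>lborel))"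
    using int by simp
  also have "(\<integral>y. ?F y \<partial>lborel) = (\<integral>y. ?E y \<partial>lborel)"
    by (rule integral_reflect[OF e, where g = ?E]) simp
  also have "(\<integral>y. ?E y \<partial>lborel) = (4 * pi * a) powr (real DIM('a) / 2)"
    using has_bochner_integral_gauss_diff[OF a, of x] by (simp add: has_bochner_integral_iff)
  finally show ?thesis by (simp add: algebra_simps)
qed

lemma integral_min_gauss_nonneg:
  "0 \<le> (\<integral>y. min (gauss a (x - y)) (gauss a (x - reflect e l y)) \<partial>lborel)"
  by (rule integral_nonneg_AE) (simp add: gauss_nonneg)

text \<open>When the plane is within \<open>sqrt a\<close> of \<open>x\<close>, both Gaussians
  dominate \<open>exp (- 2)\<close> times the narrower Gaussian at time \<open>a / 2\<close>, whose
  mass is known.\<close>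

lemma integral_min_gauss_ge:
  assumes d: "(l - x \<bullet> e)\<^sup>2 \<le> a"
  shows "(\<integral>y. min (gauss a (x - y)) (gauss a (x - reflect e l y)) \<partial>lborel) \<ge>
    exp (- 2) * (2 * pi * a) powr (real DIM('a) / 2)"
proof -
  have "has_bochner_integral lborel (\<lambda>y. gauss (a / 2) (x - y)) ((4 * pi * (a / 2)) powr (real DIM('a) / 2))"
    using a by (intro has_bochner_integral_gauss_diff) simp
  then have g: "integrable lborel (\<lambda>y. gauss (a / 2) (x - y))"
    and G: "(\<integral>y. gauss (a / 2) (x - y) \<partial>lborel) = (2 * pi * a) powr (real DIM('a) / 2)"
    by (simp_all add: has_bochner_integral_iff mult.assoc)
  have "(\<integral>y. exp (- 2) * gauss (a / 2) (x - y) \<partial>lborel)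
      \<le> (\<integral>y. min (gauss a (x - y)) (gauss a (x - reflect e l y)) \<partial>lborel)"
  proof (rule integral_mono)
    fix y
    \<comment> \<open>Here \<open>l - y \<bullet> e\<close> is at most
      \<open>(l - x \<bullet> e) + norm (x - y)\<close>; completing a square absorbs the mixed
      product and leaves \<open>8 * (l - x \<bullet> e)\<^sup>2\<close>, which is at most
      \<open>8 * a\<close>.\<close>
    have "4 * (l - x \<bullet> e) * (l - y \<bullet> e) \<le> (norm (x - y))\<^sup>2 + 8 * a"
    proof -
      have "(x - y) \<bullet> e \<le> norm (x - y)"
        using norm_cauchy_schwarz[of "x - y" e] e by simp
      then have 1: "(l - x \<bullet> e) * (l - y \<bullet> e) \<le> (l - x \<bullet> e) * ((l - x \<bullet> e) + norm (x - y))"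
        using x by (intro mult_left_mono) (auto simp: inner_simps)
      have "0 \<le> (2 * (l - x \<bullet> e) - norm (x - y))\<^sup>2" by simp
      then have "4 * (l - x \<bullet> e) * norm (x - y) \<le> 4 * (l - x \<bullet> e)\<^sup>2 + (norm (x - y))\<^sup>2"
        by (simp add: power2_diff algebra_simps power2_eq_square)
      with 1 d show ?thesis by (simp add: algebra_simps power2_eq_square)
    qed
    then have "(norm (x - reflect e l y))\<^sup>2 \<le> 2 * (norm (x - y))\<^sup>2 + 8 * a"
      unfolding norm_diff_reflect_sq[OF e] by simp
    then have "- (2 * (norm (x - y))\<^sup>2 + 8 * a) / (4 * a) \<le> - (norm (x - reflect e l y))\<^sup>2 / (4 * a)"
      using a by (intro divide_right_mono) auto
    also have "- (2 * (norm (x - y))\<^sup>2 + 8 * a) / (4 * a) = - 2 + - (norm (x - y))\<^sup>2 / (4 * (a / 2))"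
      using a by (simp add: field_simps)
    finally have 1: "exp (- 2) * gauss (a / 2) (x - y) \<le> gauss a (x - reflect e l y)"
      unfolding gauss_def exp_add[symmetric] by simp
    have "(norm (x - y))\<^sup>2 / (4 * a) \<le> (norm (x - y))\<^sup>2 / (4 * (a / 2))"
      using a by (intro divide_left_mono) auto
    then have "exp (- 2) * gauss (a / 2) (x - y) \<le> gauss a (x - y)"
      unfolding gauss_def exp_add[symmetric] exp_le_cancel_iff by simp
    with 1 show "exp (- 2) * gauss (a / 2) (x - y) \<le> min (gauss a (x - y)) (gauss a (x - reflect e l y))"
      by simp
  qed (use g in \<open>auto intro: integrable_min_gauss\<close>)
  then show ?thesis by (simp add: G)
qed

end

subsection \<open>A comparison inequality for the fractional heat operator\<close>

text \<open>The total cost of a perturbation of size \<open>min 1 a\<close>: it removes one power of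
  the singularity at 0, and at infinity the exponent is integrable by itself.\<close>

lemma has_integral_min_powr:
  assumes "0 < s" "s < 1"
  shows "((\<lambda>a. a powr (- 1 - s) * min 1 a) has_integral 1 / (1 - s) + 1 / s) {0::real..}"
proof -
  have "((\<lambda>a. a powr - s) has_integral 1 / (1 - s)) {0..1::real}"
    using has_integral_powr_from_0[of "- s" 1] assms by simp
  then have 1: "((\<lambda>a. a powr (- 1 - s) * min 1 a) has_integral 1 / (1 - s)) {0..1::real}"
  proof (rule has_integral_eq[rotated])
    show "a powr - s = a powr (- 1 - s) * min 1 a" if "a \<in> {0..1}" for a :: real
    proof -
      have "min 1 a = a" using that by simp
      then show ?thesis using that powr_mult_base[of a "- 1 - s"] by (simp add: mult.commute)
    qed
  qed
  have "((\<lambda>a. a powr (- 1 - s)) has_integral 1 / s) {1::real..}"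
    using has_integral_powr_to_inf[of "- 1 - s" 1] assms by simp
  then have 2: "((\<lambda>a. a powr (- 1 - s) * min 1 a) has_integral 1 / s) {1::real..}"
    by (rule has_integral_eq[rotated]) (simp add: min_def)
  have "{0..1} \<inter> {1..} = {1::real}" by auto
  then have "((\<lambda>a. a powr (- 1 - s) * min 1 a) has_integral 1 / (1 - s) + 1 / s) ({0..1} \<union> {1::real..})"
    by (intro has_integral_Un 1 2) simp
  moreover have "{0..1} \<union> {1::real..} = {0..}" by auto
  ultimately show ?thesis by simp
qed

text \<open>Used with \<open>b = d\<^sup>2\<close>, where \<open>d\<close> is the distance to the
  plane: from that time on the overlap is bounded below, and the weight of these times produces
  \<open>d powr (- 2 * s)\<close>.\<close>

lemma has_integral_powr_cutoff:
  assumes "0 < s" "0 < b"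
  shows "((\<lambda>a. if b \<le> a then a powr (- 1 - s) else 0) has_integral b powr - s / s) {0::real..}"
proof -
  have "((\<lambda>a. a powr (- 1 - s)) has_integral b powr - s / s) {b..}"
    using has_integral_powr_to_inf[of "- 1 - s" b] assms by simp
  then have "((\<lambda>a. if a \<in> {b..} then a powr (- 1 - s) else 0) has_integral b powr - s / s) {0..}"
    using assms by (subst has_integral_restrict) auto
  then show ?thesis by simp
qed

text \<open>Nonnegativity turns the gauge integral into a Lebesgue integral, and
  \<open>h 0 = 0\<close> reconciles the closed half-line with the open one after the substitution
  \<open>a = t - \<tau>\<close>.\<close>

lemma has_bochner_integral_time_reversal:
  fixes h :: "real \<Rightarrow> real"
  assumes "(h has_integral I) {0..}" "\<And>a. 0 \<le> h a" "h 0 = 0"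
  shows "has_bochner_integral lebesgue (\<lambda>\<tau>. indicator {..<t} \<tau> * h (t - \<tau>)) I"
proof -
  let ?k = "\<lambda>a. indicator {0..} a *\<^sub>R h a"
  have "set_integrable lebesgue {0..} h"
    using assms by (intro nonnegative_absolutely_integrable_1) auto
  then have "integrable lebesgue ?k" "integral\<^sup>L lebesgue ?k = I"
    using assms(1) set_lebesgue_integral_eq_integral(2)[of "{0..}" h]
    by (auto simp: set_integrable_def set_lebesgue_integral_def)
  then have "integrable lebesgue (\<lambda>\<tau>. ?k (t + (- 1) * \<tau>))" "(\<integral>\<tau>. ?k (t + (- 1) * \<tau>) \<partial>lebesgue) = I"
    using lebesgue_integrable_real_affine[of ?k "- 1" t] lebesgue_integral_real_affine[of "- 1" ?k t]
    by auto
  moreover have "?k (t + (- 1) * \<tau>) = indicator {..<t} \<tau> * h (t - \<tau>)" for \<tau>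
    using assms(3) by (cases "\<tau> = t") (auto simp: indicator_def)
  ultimately show ?thesis by (simp only: has_bochner_integral_iff simp_thms)
qed

text \<open>
  Since a divergent integral has the value 0, a nonzero value of \<open>frac_heat\<close> forces the
  time integral to converge.
\<close>

proposition frac_heat_reflect_diff_le:
  fixes u :: "real ^ 'n \<Rightarrow> real \<Rightarrow> real" and e x :: "real ^ 'n"
  defines "n \<equiv> CARD('n)"
  assumes s: "0 < s" "s < 1"
    and cont: "\<And>t. continuous_on UNIV (\<lambda>x. u x t)" and bdd: "\<And>x t. \<bar>u x t\<bar> \<le> M"
    and nz: "frac_heat s u x t \<noteq> 0" "frac_heat s u (reflect e l x) t \<noteq> 0"
    and e: "norm e = 1" and x: "x \<bullet> e < l"
    and W: "u (reflect e l x) t - u x t = - W" "0 \<le> W" and \<epsilon>: "0 \<le> \<epsilon>"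
    and lower: "\<And>y \<tau>. y \<bullet> e < l \<Longrightarrow> \<tau> < t \<Longrightarrow>
      - W - \<epsilon> * min 1 (t - \<tau>) \<le> u (reflect e l y) \<tau> - u y \<tau>"
  shows "frac_heat s u (reflect e l x) t - frac_heat s u x t \<le>
    frac_heat_const n s * (4 * pi) powr (real n / 2) *
      (\<epsilon> * (1 / (1 - s) + 1 / s) -
       W * (exp (- 2) * 2 powr (- (real n / 2))) * ((l - x \<bullet> e) powr (- 2 * s) / s))"
proof -
  have bdd2: "\<bar>u z \<tau> - u y \<tau>'\<bar> \<le> 2 * M" for z y \<tau> \<tau>'
    using bdd[of z \<tau>] bdd[of y \<tau>'] by linarith
  define S where "S z \<tau> = (LINT y|lebesgue. (u z t - u y \<tau>) / (t - \<tau>) powr (real n / 2 + 1 + s)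
          * exp (- (norm (z - y))\<^sup>2 / (4 * (t - \<tau>))))" for z \<tau>
  define d where "d = l - x \<bullet> e"
  define \<kappa> where "\<kappa> = exp (- 2) * 2 powr (- (real n / 2))"
  define C where "C = (4 * pi) powr (real n / 2)"
  \<comment> \<open>The bound for each time slice. The error carries
    \<open>\<epsilon> * min 1 (t - \<tau>)\<close>; the gain \<open>W * \<kappa>\<close> is claimed
    only once \<open>t - \<tau>\<close> reaches \<open>d\<^sup>2\<close>, with
    \<open>\<kappa>\<close> the guaranteed overlap as a fraction of the full mass.\<close>
  define H where "H \<tau> = C * (\<epsilon> * (indicator {..<t} \<tau> * ((t - \<tau>) powr (- 1 - s) * min 1 (t - \<tau>)))
     - W * \<kappa> * (indicator {..<t} \<tau> * (if d\<^sup>2 \<le> t - \<tau> then (t - \<tau>) powr (- 1 - s) else 0)))" for \<tau>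
  have d: "0 < d" using x by (simp add: d_def)
  have meas [measurable]: "(\<lambda>y. u y \<tau>) \<in> borel_measurable borel" for \<tau>
    by (intro borel_measurable_continuous_onI cont)
  have fh: "frac_heat s u z t = frac_heat_const n s * (\<integral>\<tau>. indicator {..<t} \<tau> *\<^sub>R S z \<tau> \<partial>lebesgue)" for z
    by (simp add: frac_heat_def S_def n_def set_lebesgue_integral_def)
  have int: "integrable lebesgue (\<lambda>\<tau>. indicator {..<t} \<tau> *\<^sub>R S z \<tau>)" if "frac_heat s u z t \<noteq> 0" for z
    using that unfolding fh by (metis mult_zero_right not_integrable_integral_eq)
  have slice: "S (reflect e l x) \<tau> - S x \<tau> \<le> H \<tau>" if \<tau>: "\<tau> < t" for \<tau>
  proof -
    define a where "a = t - \<tau>"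
    define G where "G = (4 * pi * a) powr (real n / 2)"
    define B where "B = (\<integral>y. min (gauss a (x - y)) (gauss a (x - reflect e l y)) \<partial>lborel)"
    define p where "p = real n / 2 + 1 + s"
    have a: "0 < a" using \<tau> by (simp add: a_def)
    have S: "S z \<tau> = (\<integral>y. (u z t - u y \<tau>) * gauss a (z - y) \<partial>lborel) / a powr p" for z
    proof -
      have "S z \<tau> = (LINT y|lebesgue. (u z t - u y \<tau>) * gauss a (z - y) / a powr p)"
        by (simp add: S_def a_def p_def gauss_def)
      also have "\<dots> = (LINT y|lborel. (u z t - u y \<tau>) * gauss a (z - y) / a powr p)"
        by (rule integral_completion) simp
      finally show ?thesis by simp
    qed
    have gint: "integrable lborel (\<lambda>y. gauss a (x - y))" and gG: "(\<integral>y. gauss a (x - y) \<partial>lborel) = G"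
      using has_bochner_integral_gauss_diff[OF a, of x] by (simp_all add: has_bochner_integral_iff G_def n_def)
    have bint: "integrable lborel (\<lambda>y. h y * gauss a (x - y))"
      if [measurable]: "h \<in> borel_measurable borel" and "\<And>y. \<bar>h y\<bar> \<le> K" for h :: "real ^ 'n \<Rightarrow> real" and K
      using that(2) gauss_nonneg
      by (intro Bochner_Integration.integrable_bound[OF integrable_mult_right[OF gint, of K]] AE_I2)
         (auto simp: abs_mult intro!: mult_right_mono order_trans[OF that(2) abs_ge_self])
    define w where "w y = u (reflect e l y) \<tau> - u y \<tau>" for y
    have [measurable]: "w \<in> borel_measurable borel" unfolding w_def by measurable
    have wb: "\<bar>w y\<bar> \<le> 2 * M" for y
      by (simp add: w_def bdd2)
    \<comment> \<open>Reflecting the integration variable gives both slices the same kernel, centred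
      at \<open>x\<close>.\<close>
    have "(\<integral>y. (u (reflect e l x) t - u y \<tau>) * gauss a (reflect e l x - y) \<partial>lborel)
        = (\<integral>y. (u (reflect e l x) t - u (reflect e l y) \<tau>) * gauss a (x - y) \<partial>lborel)"
      using integral_reflect[OF e, of "\<lambda>y. (u (reflect e l x) t - u y \<tau>) * gauss a (reflect e l x - y)" l]
      by (simp add: gauss_reflect[OF e])
    then have "(S (reflect e l x) \<tau> - S x \<tau>) * a powr p =
        (\<integral>y. (u (reflect e l x) t - u (reflect e l y) \<tau>) * gauss a (x - y) \<partial>lborel)
         - (\<integral>y. (u x t - u y \<tau>) * gauss a (x - y) \<partial>lborel)"
      using a by (simp add: S diff_divide_distrib[symmetric])
    also have "\<dots> = (\<integral>y. (u (reflect e l x) t - u (reflect e l y) \<tau>) * gauss a (x - y)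
         - (u x t - u y \<tau>) * gauss a (x - y) \<partial>lborel)"
      by (intro Bochner_Integration.integral_diff[symmetric] bint[where K = "2 * M"])
         (simp_all add: bdd2)
    also have "\<dots> = (\<integral>y. - W * gauss a (x - y) - w y * gauss a (x - y) \<partial>lborel)"
      unfolding W(1)[symmetric] by (intro Bochner_Integration.integral_cong) (simp_all add: w_def algebra_simps)
    also have "\<dots> = - W * G - (\<integral>y. w y * gauss a (x - y) \<partial>lborel)"
      using gint bint[OF _ wb] by (simp add: gG)
    \<comment> \<open>The antisymmetric bound with \<open>\<mu> = W + \<epsilon> * min 1 a\<close>:
      the full mass \<open>W * G\<close> cancels and only the overlap term \<open>- W * B\<close>
      survives.\<close>
    also have "\<dots> \<le> - W * G + (W + \<epsilon> * min 1 a) * (G - B)"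
      using integral_antisymmetric_gauss_ge[OF e a x, of w "2 * M" "W + \<epsilon> * min 1 a"] wb lower[OF _ \<tau>]
      by (auto simp: w_def e G_def B_def n_def a_def algebra_simps)
    also have "\<dots> = \<epsilon> * min 1 a * (G - B) - W * B" by (simp add: algebra_simps)
    also have "\<dots> \<le> \<epsilon> * min 1 a * G - W * (if d\<^sup>2 \<le> a then \<kappa> * G else 0)"
    proof -
      have "0 \<le> B" unfolding B_def by (rule integral_min_gauss_nonneg[OF e a x])
      moreover have "\<kappa> * G \<le> B" if "d\<^sup>2 \<le> a"
      proof -
        have "\<kappa> * G = exp (- 2) * (2 * pi * a) powr (real n / 2)"
        proof -
          have "G = 2 powr (real n / 2) * (2 * pi * a) powr (real n / 2)"
            using a powr_mult[of 2 "2 * pi * a" "real n / 2"] by (simp add: G_def mult.assoc[symmetric])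
          then show ?thesis by (simp add: \<kappa>_def powr_minus)
        qed
        then show ?thesis
          using integral_min_gauss_ge[OF e a x] that by (simp add: B_def n_def d_def)
      qed
      ultimately have "\<epsilon> * min 1 a * (G - B) \<le> \<epsilon> * min 1 a * G"
        "W * (if d\<^sup>2 \<le> a then \<kappa> * G else 0) \<le> W * B"
        using \<epsilon> a W(2) by (auto intro!: mult_left_mono)
      then show ?thesis by linarith
    qed
    finally have *: "(S (reflect e l x) \<tau> - S x \<tau>) * a powr p \<le>
        (\<epsilon> * min 1 a - W * (if d\<^sup>2 \<le> a then \<kappa> else 0)) * G" by (simp add: algebra_simps split: if_splits)
    have GC: "G / a powr p = C * a powr (- 1 - s)"
    proof -
      have "G = C * a powr (real n / 2)"
        using a powr_mult[of "4 * pi" a "real n / 2"] by (simp add: G_def C_def)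
      moreover have "a powr (real n / 2) / a powr p = a powr (- 1 - s)"
        by (simp add: p_def powr_diff[symmetric])
      ultimately show ?thesis by (simp only: times_divide_eq_right[symmetric])
    qed
    have "S (reflect e l x) \<tau> - S x \<tau> \<le>
        (\<epsilon> * min 1 a - W * (if d\<^sup>2 \<le> a then \<kappa> else 0)) * G / a powr p"
      using a by (subst pos_le_divide_eq) (simp, rule *)
    also have "\<dots> = (\<epsilon> * min 1 a - W * (if d\<^sup>2 \<le> a then \<kappa> else 0)) * (C * a powr (- 1 - s))"
      by (simp only: times_divide_eq_right[symmetric] GC)
    also have "\<dots> = H \<tau>"
      using \<tau> by (simp add: H_def a_def algebra_simps)
    finally show ?thesis .
  qed
  have I1: "has_bochner_integral lebesgue
      (\<lambda>\<tau>. indicator {..<t} \<tau> * ((t - \<tau>) powr (- 1 - s) * min 1 (t - \<tau>))) (1 / (1 - s) + 1 / s)"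
  proof -
    \<comment> \<open>The absolute value gives nonnegativity for negative \<open>a\<close> too, as
      the time reversal requires; it changes nothing on the half-line.\<close>
    have "((\<lambda>a. \<bar>a powr (- 1 - s) * min 1 a\<bar>) has_integral 1 / (1 - s) + 1 / s) {0::real..}"
      by (rule has_integral_eq[OF _ has_integral_min_powr[OF s]]) simp
    from has_bochner_integral_time_reversal[OF this]
    have "has_bochner_integral lebesgue
      (\<lambda>\<tau>. indicator {..<t} \<tau> * \<bar>(t - \<tau>) powr (- 1 - s) * min 1 (t - \<tau>)\<bar>) (1 / (1 - s) + 1 / s)"
      by simp
    moreover have "indicator {..<t} \<tau> * \<bar>(t - \<tau>) powr (- 1 - s) * min 1 (t - \<tau>)\<bar> =
      indicator {..<t} \<tau> * ((t - \<tau>) powr (- 1 - s) * min 1 (t - \<tau>))" for \<tau>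
      by (auto simp: indicator_def)
    ultimately show ?thesis by simp
  qed
  have I2: "has_bochner_integral lebesgue
      (\<lambda>\<tau>. indicator {..<t} \<tau> * (if d\<^sup>2 \<le> t - \<tau> then (t - \<tau>) powr (- 1 - s) else 0)) (d powr (- 2 * s) / s)"
  proof -
    have "(d\<^sup>2) powr - s = d powr (- 2 * s)"
      using d powr_powr[of d 2 "- s"] by simp
    then show ?thesis
      using has_bochner_integral_time_reversal[OF has_integral_powr_cutoff[of s "d\<^sup>2"], of t] s d by simp
  qed
  have H: "has_bochner_integral lebesgue H (C * (\<epsilon> * (1 / (1 - s) + 1 / s) - W * \<kappa> * (d powr (- 2 * s) / s)))"
    unfolding H_def by (intro has_bochner_integral_mult_right has_bochner_integral_diff I1 I2)
  have "(\<integral>\<tau>. indicator {..<t} \<tau> *\<^sub>R S (reflect e l x) \<tau> \<partial>lebesgue) - (\<integral>\<tau>. indicator {..<t} \<tau> *\<^sub>R S x \<tau> \<partial>lebesgue)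
      = (\<integral>\<tau>. indicator {..<t} \<tau> *\<^sub>R S (reflect e l x) \<tau> - indicator {..<t} \<tau> *\<^sub>R S x \<tau> \<partial>lebesgue)"
    by (intro Bochner_Integration.integral_diff[symmetric] int nz)
  also have "\<dots> \<le> integral\<^sup>L lebesgue H"
  proof (rule integral_mono)
    show "indicator {..<t} \<tau> *\<^sub>R S (reflect e l x) \<tau> - indicator {..<t} \<tau> *\<^sub>R S x \<tau> \<le> H \<tau>" for \<tau>
      using slice[of \<tau>] by (cases "\<tau> < t") (simp_all add: H_def)
  qed (use H in \<open>auto simp: has_bochner_integral_iff intro!: Bochner_Integration.integrable_diff int[simplified] nz\<close>)
  also have "\<dots> = C * (\<epsilon> * (1 / (1 - s) + 1 / s) - W * \<kappa> * (d powr (- 2 * s) / s))"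
    using H by (simp add: has_bochner_integral_iff)
  finally have "frac_heat s u (reflect e l x) t - frac_heat s u x t \<le>
      frac_heat_const n s * (C * (\<epsilon> * (1 / (1 - s) + 1 / s) - W * \<kappa> * (d powr (- 2 * s) / s)))"
    unfolding fh right_diff_distrib[symmetric]
    by (rule mult_left_mono) (simp add: frac_heat_const_def)
  then show ?thesis by (simp only: C_def d_def \<kappa>_def mult.assoc)
qed

subsection \<open>Moving planes\<close>

text \<open>Of the equation, the operator estimates keep only \<open>frac_heat_nonzero\<close>,
  which guarantees convergent time integrals.\<close>

locale decaying_positive =
  fixes s :: real and u :: "real ^ 'n \<Rightarrow> real \<Rightarrow> real"
  assumes s: "0 < s" "s < 1"
    and frac_heat_nonzero: "frac_heat s u x t \<noteq> 0"
    and pos: "0 < u x t"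
    and bdd: "bounded (range (\<lambda>(x, t). u x t))"
    and ucont: "uniformly_continuous_on UNIV (\<lambda>(x, t). u x t)"
    and lim: "uniform_limit UNIV u (\<lambda>t. 0) at_infinity"
begin

definition refl_diff :: "real ^ 'n \<Rightarrow> real \<Rightarrow> real ^ 'n \<Rightarrow> real \<Rightarrow> real" where
  "refl_diff e l x t = u (reflect e l x) t - u x t"

lemma upper_bound: obtains M where "0 < M" "\<And>x t. u x t \<le> M"
proof -
  obtain M where "\<And>z. z \<in> range (\<lambda>(x, t). u x t) \<Longrightarrow> norm z \<le> M"
    using bdd unfolding bounded_iff by blast
  then have "\<bar>u x t\<bar> \<le> M" for x t by (metis (mono_tags, lifting) case_prod_conv rangeI real_norm_def)
  then have "u x t \<le> M" for x t by (meson abs_le_D1)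
  moreover have "0 < M" using pos[of 0 0] calculation[of 0 0] by linarith
  ultimately show ?thesis using that by blast
qed

lemma decay:
  assumes "0 < r"
  obtains N where "0 < N" "\<And>x t. N \<le> norm x \<Longrightarrow> u x t < r"
proof -
  obtain b where "\<And>x t. b \<le> norm x \<Longrightarrow> dist (u x t) 0 < r"
    using uniform_limitD[OF lim assms] unfolding eventually_at_infinity by auto
  then have "\<And>x t. max 1 b \<le> norm x \<Longrightarrow> u x t < r"
    by (simp add: dist_real_def) (meson abs_less_iff)
  then show ?thesis using that[of "max 1 b"] by auto
qed

lemma continuous_on_u [continuous_intros]:
  assumes "continuous_on S g" "continuous_on S h"
  shows "continuous_on S (\<lambda>p. u (g p) (h p))"
  using continuous_on_compose2[OF uniformly_continuous_imp_continuous[OF ucont] continuous_on_Pair[OF assms]]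
  by simp

text \<open>The comparison inequality with \<open>W = 0\<close> and \<open>\<epsilon> = 0\<close>,
  to be contradicted at an interior zero of the difference.\<close>

lemma frac_heat_diff_nonpos:
  assumes e: "norm e = 1" and nonneg: "\<And>y \<tau>. y \<bullet> e < l \<Longrightarrow> 0 \<le> refl_diff e l y \<tau>"
    and x: "x \<bullet> e < l" "refl_diff e l x t = 0"
  shows "frac_heat s u (reflect e l x) t - frac_heat s u x t \<le> 0"
proof -
  obtain M where M: "0 < M" "\<And>x t. u x t \<le> M" using upper_bound by blast
  have "\<bar>u x t\<bar> \<le> M" for x t using M(2)[of x t] pos[of x t] by simp
  then show ?thesis
    using frac_heat_reflect_diff_le[of s u M x t e l 0 0] s e x nonneg frac_heat_nonzero
    by (simp add: refl_diff_def continuous_intros)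
qed

text \<open>The constant \<open>k\<close> of the maximum principle. Of the gain, half survives
  because the almost-minimum is only known to be at most \<open>- m / 2\<close>, and the
  perturbation in time may use up half of that: hence the final 4.\<close>

definition kconst :: real where
  "kconst = frac_heat_const CARD('n) s * (4 * pi) powr (real CARD('n) / 2) *
      (exp (- 2) * 2 powr (- (real CARD('n) / 2)) / s / 4)"

text \<open>A vanishing normalising constant would make \<open>frac_heat\<close> vanish, so no value
  of \<open>Gamma\<close> has to be examined.\<close>

lemma kconst_pos: "0 < kconst"
proof -
  have "frac_heat_const CARD('n) s \<noteq> 0"
    using frac_heat_nonzero[of 0 0] by (auto simp: frac_heat_def)
  moreover have "0 \<le> frac_heat_const CARD('n) s"
    by (simp add: frac_heat_const_def)
  ultimately show ?thesis using s by (simp add: kconst_def)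
qed

text \<open>
  The infimum need not be attained because \<open>t\<close> ranges over the whole line. Subtracting a
  small tent function in \<open>t\<close>, centred at an almost-minimum, produces a minimum; the error
  made in the operator is controlled by \<open>min 1 (t - \<tau>)\<close>.
\<close>

lemma almost_minimum:
  assumes e: "norm e = 1" and neg: "x0 \<bullet> e < l" "refl_diff e l x0 t0 < 0"
  obtains m x t where "0 < m" "x \<bullet> e < l" "- m \<le> refl_diff e l x t" "refl_diff e l x t \<le> - m / 2"
    "frac_heat s u (reflect e l x) t - frac_heat s u x t \<le> - kconst * m * (l - x \<bullet> e) powr (- 2 * s)"
proof -
  let ?w = "refl_diff e l"
  obtain M where M: "0 < M" "\<And>x t. u x t \<le> M" using upper_bound by blast
  have absM: "\<bar>u x t\<bar> \<le> M" for x t using M(2)[of x t] pos[of x t] by simp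
  define X where "X = (\<lambda>(y, \<tau>). - ?w y \<tau>) ` ({y. y \<bullet> e < l} \<times> UNIV)"
  define m where "m = Sup X"
  have bX: "bdd_above X"
  proof (rule bdd_aboveI)
    fix z assume "z \<in> X"
    then obtain y \<tau> where "z = - ?w y \<tau>" by (auto simp: X_def)
    then show "z \<le> M" using M(2)[of y \<tau>] pos[of "reflect e l y" \<tau>] by (simp add: refl_diff_def)
  qed
  have inX: "- ?w y \<tau> \<in> X" if "y \<bullet> e < l" for y \<tau>
    using that by (force simp: X_def)
  have low: "- m \<le> ?w y \<tau>" if "y \<bullet> e < l" for y \<tau>
    using cSup_upper[OF inX[OF that, of \<tau>] bX] by (simp add: m_def)
  have m: "0 < m" using low[OF neg(1), of t0] neg(2) by linarith
  obtain N where N: "0 < N" "\<And>x t. N \<le> norm x \<Longrightarrow> u x t < m / 2" using decay[of "m / 2"] m by auto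
  have far: "- m / 2 < ?w y \<tau>" if "N \<le> norm y" for y \<tau>
    using N(2)[OF that, of \<tau>] pos[of "reflect e l y" \<tau>] by (simp add: refl_diff_def)
  \<comment> \<open>An upper bound for the distance to the plane of the points in the half-space
    with norm at most \<open>N\<close>.\<close>
  define D where "D = \<bar>l\<bar> + N"
  define A where "A = 1 / (1 - s) + 1 / s"
  define Q where "Q = exp (- 2) * 2 powr (- (real CARD('n) / 2)) / s"
  \<comment> \<open>The first bound keeps the perturbed minimum inside the ball of radius
    \<open>N\<close> and its value below \<open>- m / 2\<close>; the second limits the error
    \<open>\<epsilon> * A\<close> to half of the available gain.\<close>
  define \<epsilon> where "\<epsilon> = min (m / 4) (m / 4 * Q * D powr (- 2 * s) / A)"
  have A: "0 < A" and Q: "0 < Q" and D: "0 < D" using s N by (auto simp: A_def Q_def D_def add_pos_pos)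
  have \<epsilon>: "0 < \<epsilon>" "\<epsilon> \<le> m / 4" "\<epsilon> * A \<le> m / 4 * Q * D powr (- 2 * s)"
  proof -
    have "\<epsilon> \<le> m / 4 * Q * D powr (- 2 * s) / A" by (simp add: \<epsilon>_def)
    then show "\<epsilon> * A \<le> m / 4 * Q * D powr (- 2 * s)" using A by (simp add: pos_le_divide_eq)
  qed (use m A Q D in \<open>auto simp: \<epsilon>_def\<close>)
  obtain x1 t1 where 1: "x1 \<bullet> e < l" "?w x1 t1 < - m + \<epsilon>"
  proof -
    have "X \<noteq> {}" using inX[OF neg(1)] by blast
    then have "\<exists>z\<in>X. m - \<epsilon> < z"
      using less_cSup_iff[of X "m - \<epsilon>"] bX \<epsilon>(1) by (simp add: m_def)
    then obtain y \<tau> where "y \<bullet> e < l" "m - \<epsilon> < - ?w y \<tau>" by (auto simp: X_def)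
    then show ?thesis using that[of y \<tau>] by linarith
  qed
  \<comment> \<open>The tent takes values in \<open>{0..1}\<close> and is 1-Lipschitz, so its
    increments are at most \<open>min 1 (t - \<tau>)\<close>.\<close>
  define \<eta> where "\<eta> \<tau> = max 0 (1 - \<bar>\<tau> - t1\<bar>)" for \<tau>
  define v where "v y \<tau> = ?w y \<tau> - \<epsilon> * \<eta> \<tau>" for y \<tau>
  define K where "K = (cball 0 N \<inter> {y. y \<bullet> e \<le> l}) \<times> cball t1 1"
  have "norm x1 < N" using far[of x1 t1] 1(2) \<epsilon>(2) m by force
  then have K1: "(x1, t1) \<in> K" using 1 by (simp add: K_def)
  have "closed {y. y \<bullet> e \<le> l}" by (intro closed_Collect_le continuous_intros)
  then have "compact K" unfolding K_def by (intro compact_Times compact_Int_closed) auto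
  moreover have "continuous_on K (\<lambda>p. v (fst p) (snd p))"
    unfolding v_def refl_diff_def \<eta>_def by (intro continuous_intros)
  ultimately obtain x t where xt: "(x, t) \<in> K" and min: "\<And>y \<tau>. (y, \<tau>) \<in> K \<Longrightarrow> v x t \<le> v y \<tau>"
    using continuous_attains_inf[of K "\<lambda>p. v (fst p) (snd p)"] K1 by fastforce
  \<comment> \<open>At its centre the tent pushes \<open>v\<close> below the infimum
    \<open>- m\<close> of the unperturbed difference, so the minimum over \<open>K\<close> also
    beats all points of the half-space outside \<open>K\<close>.\<close>
  have "v x1 t1 < - m" using 1 by (simp add: v_def \<eta>_def)
  then have vm: "v x t < - m" using min[OF K1] by linarith
  have \<eta>: "0 \<le> \<eta> \<tau>" "\<eta> \<tau> \<le> 1" for \<tau> by (auto simp: \<eta>_def)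
  have \<epsilon>\<eta>: "0 \<le> \<epsilon> * \<eta> \<tau>" "\<epsilon> * \<eta> \<tau> \<le> \<epsilon>" for \<tau>
    using \<epsilon>(1) \<eta>[of \<tau>] by (auto simp: mult_left_le)
  have wW: "?w x t \<le> - m / 2" using vm \<epsilon>\<eta>[of t] \<epsilon>(2) m by (simp add: v_def)
  have xl: "x \<bullet> e < l"
  proof (rule ccontr)
    assume "\<not> x \<bullet> e < l"
    then have "x \<bullet> e = l" using xt by (simp add: K_def)
    then have "?w x t = 0" by (simp add: refl_diff_def reflect_def)
    then show False using wW m by simp
  qed
  have "norm x < N" using far[of x t] wW by force
  then have "\<bar>x \<bullet> e\<bar> \<le> N" using Cauchy_Schwarz_ineq2[of x e] e by simp
  then have d: "0 < l - x \<bullet> e" "l - x \<bullet> e \<le> D" using xl by (auto simp: D_def)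
  define W where "W = - ?w x t"
  have W: "m / 2 \<le> W" "W \<le> m" using wW low[OF xl, of t] by (auto simp: W_def)
  have lower: "- W - \<epsilon> * min 1 (t - \<tau>) \<le> ?w y \<tau>" if y: "y \<bullet> e < l" and \<tau>: "\<tau> < t" for y \<tau>
  proof -
    have "v x t \<le> v y \<tau>"
    proof (cases "(y, \<tau>) \<in> K")
      case False
      \<comment> \<open>Outside \<open>K\<close> either decay gives
        \<open>v > - m / 2 - \<epsilon>\<close>, or the tent vanishes and
        \<open>v \<ge> - m\<close>.\<close>
      then consider "N \<le> norm y" | "1 < dist t1 \<tau>" using y by (force simp: K_def)
      then show ?thesis
      proof cases
        case 1
        then show ?thesis using far[OF 1, of \<tau>] vm \<epsilon>\<eta>[of \<tau>] \<epsilon>(2) m by (simp add: v_def)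
      next
        case 2
        then have "\<eta> \<tau> = 0" by (simp add: \<eta>_def dist_real_def)
        then show ?thesis using low[OF y, of \<tau>] vm by (simp add: v_def)
      qed
    qed (rule min)
    then have "- W - \<epsilon> * (\<eta> t - \<eta> \<tau>) \<le> ?w y \<tau>" by (simp add: v_def W_def algebra_simps)
    moreover have "\<epsilon> * (\<eta> t - \<eta> \<tau>) \<le> \<epsilon> * min 1 (t - \<tau>)"
      using \<epsilon>(1) \<tau> by (intro mult_left_mono) (auto simp: \<eta>_def)
    ultimately show ?thesis by linarith
  qed
  have "frac_heat s u (reflect e l x) t - frac_heat s u x t \<le>
      frac_heat_const CARD('n) s * (4 * pi) powr (real CARD('n) / 2) *
      (\<epsilon> * A - W * (exp (- 2) * 2 powr (- (real CARD('n) / 2))) * ((l - x \<bullet> e) powr (- 2 * s) / s))"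
    unfolding A_def
    by (rule frac_heat_reflect_diff_le[where M = M])
       (use s e xl W m \<epsilon>(1) lower absM frac_heat_nonzero in
         \<open>auto simp: W_def refl_diff_def continuous_intros\<close>)
  also have "\<dots> \<le> frac_heat_const CARD('n) s * (4 * pi) powr (real CARD('n) / 2) *
      (- (Q / 4 * m * (l - x \<bullet> e) powr (- 2 * s)))"
  proof (rule mult_left_mono)
    have "D powr (- 2 * s) \<le> (l - x \<bullet> e) powr (- 2 * s)"
      using d s by (intro powr_mono2') auto
    then have "m / 4 * Q * D powr (- 2 * s) \<le> m / 4 * Q * (l - x \<bullet> e) powr (- 2 * s)"
      using m Q by (intro mult_left_mono) auto
    moreover have "m / 2 * (Q * (l - x \<bullet> e) powr (- 2 * s)) \<le> W * (Q * (l - x \<bullet> e) powr (- 2 * s))"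
      using W Q by (intro mult_right_mono) auto
    moreover have "W * (exp (- 2) * 2 powr (- (real CARD('n) / 2))) * ((l - x \<bullet> e) powr (- 2 * s) / s)
        = W * (Q * (l - x \<bullet> e) powr (- 2 * s))"
      by (simp add: Q_def)
    ultimately show "\<epsilon> * A - W * (exp (- 2) * 2 powr (- (real CARD('n) / 2))) * ((l - x \<bullet> e) powr (- 2 * s) / s)
        \<le> - (Q / 4 * m * (l - x \<bullet> e) powr (- 2 * s))"
      using \<epsilon>(3) by (simp only:) (simp add: algebra_simps)
  qed (simp add: frac_heat_const_def)
  also have "\<dots> = - kconst * m * (l - x \<bullet> e) powr (- 2 * s)"
    by (simp add: kconst_def Q_def)
  finally show ?thesis
    using that m xl low[OF xl] wW by blast
qed

end

section \<open>Quantitative consequences of the hypotheses on \<open>R\<close> and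
  \<open>f\<close>\<close>

text \<open>A continuous positive function on a compact set of pairs has a positive minimum. The gap
  is measured in squares because reflection changes squared norms by an explicit amount.\<close>

lemma uniform_decrease_on_compact:
  fixes R :: "real \<Rightarrow> real"
  assumes R: "continuous_on {0..} R" "strict_antimono_on {0..} R" and \<theta>: "0 < \<theta>"
  obtains \<omega> where "0 < \<omega>" "\<And>a b. 0 \<le> a \<Longrightarrow> a \<le> b \<Longrightarrow> b \<le> \<rho> \<Longrightarrow> \<theta> \<le> b\<^sup>2 - a\<^sup>2 \<Longrightarrow> \<omega> \<le> R a - R b"
proof -
  define K where "K = ({0..\<rho>} \<times> {0..\<rho>}) \<inter> {p. fst p \<le> snd p} \<inter> {p. \<theta> \<le> (snd p)\<^sup>2 - (fst p)\<^sup>2}"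
  have K: "(a, b) \<in> K" if "0 \<le> a" "a \<le> b" "b \<le> \<rho>" "\<theta> \<le> b\<^sup>2 - a\<^sup>2" for a b
    using that by (simp add: K_def)
  show ?thesis
  proof (cases "K = {}")
    case True
    then show ?thesis using that[of 1] K by fastforce
  next
    case False
    have "closed {p::real \<times> real. fst p \<le> snd p}" "closed {p::real \<times> real. \<theta> \<le> (snd p)\<^sup>2 - (fst p)\<^sup>2}"
      by (intro closed_Collect_le continuous_intros)+
    then have "compact K" unfolding K_def by (intro compact_Int_closed compact_Times) auto
    moreover have "continuous_on K (\<lambda>p. R (fst p) - R (snd p))"
      by (intro continuous_intros continuous_on_compose2[OF R(1)]) (auto simp: K_def)
    ultimately obtain a b where ab: "(a, b) \<in> K" and min: "\<And>p. p \<in> K \<Longrightarrow> R a - R b \<le> R (fst p) - R (snd p)"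
      using continuous_attains_inf[of K "\<lambda>p. R (fst p) - R (snd p)"] False by fastforce
    have "a \<noteq> b" using ab \<theta> by (auto simp: K_def)
    then have "R b < R a"
      using ab monotone_onD[OF R(2), of a b] by (auto simp: K_def)
    then show ?thesis using that[of "R a - R b"] min K by fastforce
  qed
qed

text \<open>By continuity \<open>f'\<close> stays negative on a short interval; the mean value
  theorem does the rest.\<close>

lemma antitone_near_zero:
  fixes f f' :: "real \<Rightarrow> real"
  assumes \<delta>: "0 < \<delta>" and f: "\<And>r. r \<in> {0..\<delta>} \<Longrightarrow> (f has_real_derivative f' r) (at r within {0..\<delta>})"
    and f': "continuous_on {0..\<delta>} f'" "f' 0 < 0"
  obtains r where "0 < r" "\<And>a b. 0 \<le> a \<Longrightarrow> a \<le> b \<Longrightarrow> b \<le> r \<Longrightarrow> f b \<le> f a"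
proof -
  obtain d where d: "0 < d" "\<And>y. y \<in> {0..\<delta>} \<Longrightarrow> dist y 0 < d \<Longrightarrow> dist (f' y) (f' 0) < - f' 0"
    using f' \<delta> unfolding continuous_on_iff by (metis atLeastAtMost_iff le_less neg_0_less_iff_less)
  define r where "r = min \<delta> (d / 2)"
  have r: "0 < r" "r \<le> \<delta>" "r < d" using \<delta> d(1) by (auto simp: r_def)
  have neg: "f' y < 0" if "0 \<le> y" "y \<le> r" for y
    using d(2)[of y] that r by (simp add: dist_real_def)
  show ?thesis
  proof (rule that[OF r(1)])
    fix a b :: real assume ab: "0 \<le> a" "a \<le> b" "b \<le> r"
    obtain z where z: "z \<in> {a..b}" "f b - f a = f' z * (b - a)"
    proof -
      have "(f has_derivative (*) (f' z)) (at z within {a..b})" if "a \<le> z" "z \<le> b" for z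
        using f[of z] ab r that unfolding has_field_derivative_def
        by (auto intro: has_derivative_subset)
      then show ?thesis using mvt_very_simple[OF ab(2), of f "\<lambda>z. (*) (f' z)"] that by auto
    qed
    then have "f b - f a \<le> 0" using neg[of z] ab by (simp add: mult_nonpos_nonneg)
    then show "f b \<le> f a" by simp
  qed
qed

text \<open>Compactness of \<open>{0..M}\<close>, applied to a family over the one-point parameter
  set \<open>{0}\<close> because \<open>local_lipschitz\<close> speaks of parametrised
  functions.\<close>

lemma lipschitz_on_Icc_if_locally:
  fixes f :: "real \<Rightarrow> real"
  assumes "\<forall>r\<ge>0. \<exists>d>0. \<exists>L. L-lipschitz_on (cball r d \<inter> {0..}) f"
  obtains L where "L-lipschitz_on {0..M} f"
proof -
  have "local_lipschitz {0::real} {0..M} (\<lambda>_. f)"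
  proof (rule local_lipschitzI)
    fix r :: real assume "r \<in> {0..M}"
    then obtain d L where "0 < d" "L-lipschitz_on (cball r d \<inter> {0..}) f" using assms by auto
    then show "\<exists>d>0. \<exists>L. \<forall>t\<in>cball t d \<inter> {0}. L-lipschitz_on (cball r d \<inter> {0..M}) f" for t
      by (intro exI[of _ d] exI[of _ L] conjI ballI) (auto elim: lipschitz_on_subset)
  qed
  then obtain L where "\<And>t. t \<in> {0::real} \<Longrightarrow> L-lipschitz_on {0..M} f"
    using local_lipschitz_compact_implies_lipschitz[of "{0::real}" "{0..M}" "\<lambda>_. f"] by auto
  then show ?thesis using that by blast
qed

text \<open>The hypotheses on \<open>f\<close> enter as constants: \<open>c\<close> and
  \<open>L\<close> on \<open>{0..M}\<close>, which contains the values of \<open>u\<close>, and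
  \<open>r\<close> for the values of \<open>u\<close> far out.\<close>

locale moving_planes = decaying_positive s u for s and u :: "real ^ 'n \<Rightarrow> real \<Rightarrow> real" +
  fixes R f :: "real \<Rightarrow> real" and c L M r :: real
  assumes R: "continuous_on {0..} R" "strict_antimono_on {0..} R" "\<And>a. 0 \<le> a \<Longrightarrow> 0 < R a"
    and eq: "\<And>x t. frac_heat s u x t = R (norm x) * f (u x t)"
    and M: "\<And>x t. u x t \<le> M"
    and f_lower: "0 < c" "\<And>a. 0 \<le> a \<Longrightarrow> a \<le> M \<Longrightarrow> c \<le> f a"
    and f_lipschitz: "L-lipschitz_on {0..M} f"
    and f_antitone: "0 < r" "\<And>a b. 0 \<le> a \<Longrightarrow> a \<le> b \<Longrightarrow> b \<le> r \<Longrightarrow> f b \<le> f a"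
begin

lemma R_antimono: "0 \<le> a \<Longrightarrow> a \<le> b \<Longrightarrow> R b \<le> R a"
  using monotone_onD[OF R(2), of a b] by (cases "a = b") auto

lemma f_u: "c \<le> f (u x t)"
  using f_lower(2)[of "u x t"] pos[of x t] M[of x t] by simp

lemma norm_reflect_le:
  assumes "norm e = 1" "l \<le> 0" "x \<bullet> e < l"
  shows "norm (reflect e l x) \<le> norm x"
proof -
  have "l * (l - x \<bullet> e) \<le> 0" using assms by (intro mult_nonpos_nonneg) auto
  then have "(norm (reflect e l x))\<^sup>2 \<le> (norm x)\<^sup>2" using assms by (simp add: norm_reflect_sq)
  then show ?thesis by (simp add: power2_le_iff_abs_le)
qed

text \<open>
  As the plane moves, a negative value of \<open>refl_diff\<close> cannot appear gradually: near the plane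
  the factor \<open>(l - x \<bullet> e) powr (- 2 * s)\<close> beats the Lipschitz constant of \<open>f\<close>, and away from
  it the strict decrease of \<open>R\<close> gives a source term bounded below.
\<close>

lemma refl_diff_gap:
  assumes l1: "l1 < 0"
  obtains m0 where "0 < m0"
    "\<And>e l x t. norm e = 1 \<Longrightarrow> l \<le> l1 \<Longrightarrow> x \<bullet> e < l \<Longrightarrow> refl_diff e l x t < 0 \<Longrightarrow>
      \<exists>y \<tau>. y \<bullet> e < l \<and> refl_diff e l y \<tau> < - m0"
proof -
  obtain \<rho> where \<rho>: "0 < \<rho>" "\<And>x t. \<rho> \<le> norm x \<Longrightarrow> u x t < r" using decay[OF f_antitone(1)] by blast
  have L: "0 \<le> L" using f_lipschitz lipschitz_on_nonneg by blast
  define \<Lambda> where "\<Lambda> = R 0 * L"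
  have \<Lambda>: "0 \<le> \<Lambda>" using L R(3)[of 0] by (simp add: \<Lambda>_def)
  \<comment> \<open>Chosen so that at distance \<open>\<eta>\<close> from the plane the gain per
    unit of \<open>m\<close> is \<open>\<Lambda> + 1\<close>, more than the Lipschitz loss
    \<open>\<Lambda>\<close>.\<close>
  define \<eta> where "\<eta> = (kconst / (\<Lambda> + 1)) powr (1 / (2 * s))"
  have \<eta>: "0 < \<eta>" using kconst_pos \<Lambda> by (simp add: \<eta>_def)
  have \<eta>s: "kconst * \<eta> powr (- 2 * s) = \<Lambda> + 1"
  proof -
    have "\<eta> powr (- 2 * s) = (kconst / (\<Lambda> + 1)) powr - 1"
      using s by (simp add: \<eta>_def powr_powr)
    then show ?thesis using kconst_pos \<Lambda> by (simp add: powr_minus)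
  qed
  have "0 < 4 * - l1 * \<eta>" using l1 \<eta> by (simp add: mult_neg_pos)
  then obtain \<omega> where \<omega>: "0 < \<omega>"
    "\<And>a b. 0 \<le> a \<Longrightarrow> a \<le> b \<Longrightarrow> b \<le> \<rho> \<Longrightarrow> 4 * - l1 * \<eta> \<le> b\<^sup>2 - a\<^sup>2 \<Longrightarrow> \<omega> \<le> R a - R b"
    using uniform_decrease_on_compact[OF R(1,2)] by blast
  \<comment> \<open>The source \<open>\<omega> * c\<close> will be at most
    \<open>(\<Lambda> + 1) * m\<close>, so \<open>4 * m0 \<le> m\<close>; the factor 4 leaves
    \<open>- m / 2\<close> strictly below \<open>- m0\<close>.\<close>
  define m0 where "m0 = \<omega> * c / (\<Lambda> + 1) / 4"
  have m0: "0 < m0" "4 * m0 * (\<Lambda> + 1) = \<omega> * c"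
    using \<omega>(1) f_lower(1) \<Lambda> by (auto simp: m0_def field_simps)
  show ?thesis
  proof (rule that[OF m0(1)])
    fix e l x0 t0
    assume e: "norm e = 1" and l: "l \<le> l1" and neg: "x0 \<bullet> e < l" "refl_diff e l x0 t0 < 0"
    obtain m x t where m: "0 < m" and x: "x \<bullet> e < l" and w: "- m \<le> refl_diff e l x t" "refl_diff e l x t \<le> - m / 2"
      and fh: "frac_heat s u (reflect e l x) t - frac_heat s u x t \<le> - kconst * m * (l - x \<bullet> e) powr (- 2 * s)"
      using almost_minimum[OF e neg] by blast
    define a where "a = norm (reflect e l x)"
    define b where "b = norm x"
    define d where "d = l - x \<bullet> e"
    define v where "v = u (reflect e l x) t"
    have d: "0 < d" using x by (simp add: d_def)
    have ab: "0 \<le> a" "a \<le> b"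
      using norm_reflect_le[OF e _ x] l l1 by (auto simp: a_def b_def)
    have v: "0 < v" "v \<le> M" "v \<le> u x t" "u x t - v \<le> m"
      using pos M w m by (auto simp: v_def refl_diff_def)
    have fh': "R a * f v - R b * f (u x t) \<le> - kconst * m * d powr (- 2 * s)"
      using fh by (simp add: eq a_def b_def d_def v_def)
    have kd: "0 < kconst * m * d powr (- 2 * s)" using kconst_pos m d by simp
    have Rab: "R b \<le> R a" "0 < R b" "R b \<le> R 0" using ab R_antimono R(3)[of b] by auto
    \<comment> \<open>Far out both values of \<open>u\<close> lie where \<open>f\<close> is
      antitone, so the right-hand sides have a nonnegative difference, against the negative bound on
      the operator.\<close>
    have b\<rho>: "b \<le> \<rho>"
    proof (rule ccontr)
      assume "\<not> b \<le> \<rho>"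
      then have "u x t < r" using \<rho>(2)[of x t] by (simp add: b_def)
      then have "f (u x t) \<le> f v" using f_antitone(2)[of v "u x t"] v by simp
      then have "R b * f (u x t) \<le> R a * f v"
        using Rab f_u[of x t] f_lower(1) by (intro mult_mono) auto
      then show False using fh' kd by linarith
    qed
    have fL: "f (u x t) - f v \<le> L * m"
    proof -
      have "\<bar>f (u x t) - f v\<bar> \<le> L * \<bar>u x t - v\<bar>"
        using lipschitz_onD[OF f_lipschitz, of "u x t" v] v M[of x t] by (simp add: dist_real_def)
      also have "\<dots> \<le> L * m" using v L by (intro mult_left_mono) auto
      finally show ?thesis by simp
    qed
    have "R b * (f (u x t) - f v) \<le> R b * (L * m)" using fL Rab by (intro mult_left_mono) auto
    also have "\<dots> \<le> \<Lambda> * m" unfolding \<Lambda>_def mult.assoc using Rab L m by (intro mult_right_mono) auto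
    finally have main: "(R a - R b) * f v \<le> \<Lambda> * m - kconst * m * d powr (- 2 * s)"
      using fh' by (simp add: algebra_simps)
    have fv: "c \<le> f v" using f_lower(2)[of v] v by simp
    have \<eta>d: "\<eta> \<le> d"
    proof (rule ccontr)
      assume "\<not> \<eta> \<le> d"
      then have "\<eta> powr (- 2 * s) \<le> d powr (- 2 * s)" using d s by (intro powr_mono2') auto
      then have "\<Lambda> + 1 \<le> kconst * d powr (- 2 * s)" unfolding \<eta>s[symmetric] using kconst_pos by (intro mult_left_mono) auto
      then have "(\<Lambda> + 1) * m \<le> kconst * d powr (- 2 * s) * m" using m by (intro mult_right_mono) auto
      moreover have "0 \<le> (R a - R b) * f v" using Rab fv f_lower(1) by simp
      ultimately show False using main m by (simp add: algebra_simps)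
    qed
    have "4 * - l1 * \<eta> \<le> 4 * - l * d" using l l1 \<eta>d \<eta> by (intro mult_mono) auto
    also have "\<dots> = b\<^sup>2 - a\<^sup>2" by (simp add: a_def b_def d_def norm_reflect_sq[OF e])
    finally have "\<omega> \<le> R a - R b" using \<omega>(2) ab b\<rho> by blast
    then have "\<omega> * c \<le> (R a - R b) * f v" using fv f_lower(1) \<omega>(1) by (intro mult_mono) auto
    then have "4 * m0 * (\<Lambda> + 1) \<le> m * (\<Lambda> + 1)" using main kd m m0(2) by (simp add: algebra_simps)
    then have "4 * m0 \<le> m" using \<Lambda> by simp
    then have "refl_diff e l x t < - m0" using w(2) m0(1) by linarith
    then show "\<exists>y \<tau>. y \<bullet> e < l \<and> refl_diff e l y \<tau> < - m0" using x by blast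
  qed
qed

text \<open>The plane is moved in steps of fixed length. By uniform continuity one step changes the
  difference by less than \<open>m0\<close>, while the gap says that any negative value forces one
  below \<open>- m0\<close>; so nonnegativity passes from each plane to the next.\<close>

lemma refl_diff_nonneg:
  assumes e: "norm e = 1" and l: "l < 0" and x: "x \<bullet> e < l"
  shows "0 \<le> refl_diff e l x t"
proof -
  obtain m0 where m0: "0 < m0"
    and gap: "\<And>l' x t. l' \<le> l \<Longrightarrow> x \<bullet> e < l' \<Longrightarrow> refl_diff e l' x t < 0 \<Longrightarrow>
      \<exists>y \<tau>. y \<bullet> e < l' \<and> refl_diff e l' y \<tau> < - m0"
    using refl_diff_gap[OF l] e by metis
  obtain N where N: "0 < N" "\<And>x t. N \<le> norm x \<Longrightarrow> u x t < m0" using decay[OF m0] by blast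
  obtain \<delta> where \<delta>: "0 < \<delta>" "\<And>x y t. norm (x - y) < \<delta> \<Longrightarrow> \<bar>u x t - u y t\<bar> < m0 / 2"
  proof -
    obtain \<delta> where "0 < \<delta>" and
      *: "\<And>p q. dist p q < \<delta> \<Longrightarrow> dist (case p of (x, t) \<Rightarrow> u x t) (case q of (x, t) \<Rightarrow> u x t) < m0 / 2"
      using ucont m0 unfolding uniformly_continuous_on_def by (metis UNIV_I half_gt_zero dist_commute)
    moreover have "\<bar>u x t - u y t\<bar> < m0 / 2" if "norm (x - y) < \<delta>" for x y t
      using *[of "(x, t)" "(y, t)"] that by (simp add: dist_Pair_Pair dist_norm)
    ultimately show ?thesis using that by blast
  qed
  have "l' \<le> l \<Longrightarrow> l' \<le> - N + real k * (\<delta> / 2) \<Longrightarrow> x \<bullet> e < l' \<Longrightarrow> 0 \<le> refl_diff e l' x t" for k l' x t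
  proof (induction k arbitrary: l' x t)
    case 0
    show ?case
    proof (rule ccontr)
      assume "\<not> 0 \<le> refl_diff e l' x t"
      then obtain y \<tau> where y: "y \<bullet> e < l'" "refl_diff e l' y \<tau> < - m0"
        using gap[of l' x t] 0 by auto
      \<comment> \<open>For planes left of \<open>- N\<close> the whole half-space lies where
        \<open>u\<close> is below \<open>m0\<close>, so positivity of the reflected value excludes
        the gap.\<close>
      have "N \<le> norm y" using Cauchy_Schwarz_ineq2[of y e] e 0 y(1) by simp
      then show False using N(2)[of y \<tau>] pos[of "reflect e l' y" \<tau>] y(2) by (simp add: refl_diff_def)
    qed
  next
    case (Suc k)
    show ?case
    proof (rule ccontr)
      assume "\<not> 0 \<le> refl_diff e l' x t"
      then obtain y \<tau> where y: "y \<bullet> e < l'" "refl_diff e l' y \<tau> < - m0"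
        using gap[of l' x t] Suc.prems by auto
      \<comment> \<open>Moving the point and the plane together by \<open>\<delta> / 2\<close>
        translates the mirror image by the same vector; the two values of \<open>u\<close> then
        change by less than \<open>m0 / 2\<close> each.\<close>
      define z where "z = y - (\<delta> / 2) *\<^sub>R e"
      have ee: "e \<bullet> e = 1" using e by (simp add: norm_eq_1)
      have z: "z \<bullet> e < l' - \<delta> / 2" using y(1) by (simp add: z_def inner_simps ee)
      have "reflect e (l' - \<delta> / 2) z = reflect e l' y - (\<delta> / 2) *\<^sub>R e"
        by (simp add: z_def reflect_def inner_simps ee algebra_simps)
      then have "norm (reflect e (l' - \<delta> / 2) z - reflect e l' y) < \<delta>" "norm (z - y) < \<delta>"
        using \<delta>(1) e by (simp_all add: z_def)
      then have "\<bar>u (reflect e (l' - \<delta> / 2) z) \<tau> - u (reflect e l' y) \<tau>\<bar> < m0 / 2" "\<bar>u z \<tau> - u y \<tau>\<bar> < m0 / 2"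
        by (blast intro: \<delta>(2))+
      moreover have "0 \<le> refl_diff e (l' - \<delta> / 2) z \<tau>"
        using Suc.prems \<delta>(1) by (intro Suc.IH z) (auto simp: algebra_simps)
      ultimately show False using y(2) unfolding refl_diff_def by linarith
    qed
  qed
  moreover obtain k :: nat where "(l + N) / (\<delta> / 2) \<le> real k"
    using real_arch_simple by blast
  then have "l \<le> - N + real k * (\<delta> / 2)" using \<delta>(1) by (simp add: field_simps)
  ultimately show ?thesis using x by blast
qed

text \<open>At a zero the two values of \<open>f\<close> agree and are positive, so the sign of the
  operator difference would contradict the strict decrease of \<open>R\<close>.\<close>

lemma refl_diff_pos:
  assumes e: "norm e = 1" and l: "l < 0" and x: "x \<bullet> e < l"
  shows "0 < refl_diff e l x t"
proof (rule ccontr)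
  assume "\<not> 0 < refl_diff e l x t"
  then have 0: "refl_diff e l x t = 0" using refl_diff_nonneg[OF assms, of t] by simp
  have "frac_heat s u (reflect e l x) t - frac_heat s u x t \<le> 0"
    by (rule frac_heat_diff_nonpos[OF e refl_diff_nonneg[OF e l] x 0])
  then have le: "R (norm (reflect e l x)) * f (u x t) \<le> R (norm x) * f (u x t)"
    using 0 by (simp add: eq refl_diff_def)
  have "l * (l - x \<bullet> e) < 0" using l x by (intro mult_neg_pos) auto
  then have "(norm (reflect e l x))\<^sup>2 < (norm x)\<^sup>2" by (simp add: norm_reflect_sq[OF e])
  then have "norm (reflect e l x) < norm x" by (simp add: power2_less_imp_less)
  then have "R (norm x) < R (norm (reflect e l x))" using monotone_onD[OF R(2)] by simp
  then show False using le f_u[of x t] f_lower(1) by simp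
qed

section \<open>From moving planes to radial symmetry\<close>

text \<open>The perpendicular bisector of \<open>x\<close> and \<open>y\<close> exchanges them, and
  \<open>norm x < norm y\<close> puts the origin on the side of \<open>x\<close>, that is
  \<open>l < 0\<close>.\<close>

lemma radially_decreasing:
  assumes "norm x < norm y"
  shows "u y t < u x t"
proof -
  define D where "D = norm (x - y)"
  define e where "e = (1 / D) *\<^sub>R (x - y)"
  \<comment> \<open>The inner product of \<open>e\<close> with the midpoint of \<open>x\<close> and
    \<open>y\<close>.\<close>
  define l where "l = ((norm x)\<^sup>2 - (norm y)\<^sup>2) / (2 * D)"
  have D: "0 < D" using assms by (auto simp: D_def)
  have e: "norm e = 1" using D by (simp add: e_def D_def[symmetric])
  have "(norm x)\<^sup>2 < (norm y)\<^sup>2" using assms by (intro power_strict_mono) auto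
  then have l: "l < 0" using D by (simp add: l_def divide_neg_pos)
  have DD: "D * D = (norm x)\<^sup>2 - 2 * (x \<bullet> y) + (norm y)\<^sup>2"
    by (simp add: D_def power2_norm_eq_inner[symmetric] power2_eq_square[symmetric])
       (simp add: power2_norm_eq_inner inner_simps inner_commute)
  have ye: "y \<bullet> e = (x \<bullet> y - (norm y)\<^sup>2) / D"
    by (simp add: e_def inner_simps inner_commute power2_norm_eq_inner)
  have "2 * (l - y \<bullet> e) = (D * D) / D"
    unfolding l_def ye DD by (simp add: diff_divide_distrib add_divide_distrib)
  then have ly: "2 * (l - y \<bullet> e) = D" using D by simp
  then have "reflect e l y = x" using D by (simp add: reflect_def e_def)
  moreover have "y \<bullet> e < l"
  proof -
    have "0 < 2 * (l - y \<bullet> e)" using ly D by simp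
    then show ?thesis by simp
  qed
  ultimately show ?thesis using refl_diff_pos[OF e l, of y t] by (simp add: refl_diff_def)
qed

text \<open>Points slightly farther out on the ray through \<open>x\<close> have larger norm than
  \<open>y\<close>, hence smaller values; letting them tend to \<open>x\<close> gives one
  inequality, and exchanging \<open>x\<close> and \<open>y\<close> the other.\<close>

lemma radially_symmetric:
  assumes "norm x = norm y"
  shows "u x t = u y t"
proof -
  have le: "u x t \<le> u y t" if xy: "norm x = norm y" for x y
  proof (cases "x = 0")
    case False
    have "(\<lambda>k. u ((1 + inverse (real (Suc k))) *\<^sub>R x) t) \<longlonglongrightarrow> u ((1 + 0) *\<^sub>R x) t"
    proof (rule continuous_on_tendsto_compose[where s = UNIV and f = "\<lambda>x. u x t"])
      show "(\<lambda>k. (1 + inverse (real (Suc k))) *\<^sub>R x) \<longlonglongrightarrow> (1 + 0) *\<^sub>R x"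
        by (intro tendsto_intros LIMSEQ_inverse_real_of_nat)
    qed (auto intro!: continuous_intros)
    moreover have "u ((1 + inverse (real (Suc k))) *\<^sub>R x) t \<le> u y t" for k
    proof -
      have "1 * norm x < (1 + inverse (real (Suc k))) * norm x"
        using False by (intro mult_strict_right_mono) auto
      then have "norm y < norm ((1 + inverse (real (Suc k))) *\<^sub>R x)"
        using xy by (simp add: abs_of_pos add_pos_pos)
      then show ?thesis using radially_decreasing less_imp_le by blast
    qed
    ultimately show ?thesis using LIMSEQ_le_const2 by fastforce
  qed (use xy in simp)
  show ?thesis using le[of x y] le[of y x] assms by simp
qed

end

theorem theorem1:
  fixes s :: real
    and R f f' :: "real \<Rightarrow> real"
    and \<delta> \<sigma> :: real
    and u :: "real ^ 'n \<Rightarrow> real \<Rightarrow> real"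
  assumes "0 < s" and "s < 1"
    and "continuous_on {0..} R" and "strict_antimono_on {0..} R" and "\<forall>r\<ge>0. R r > 0"
    and "\<forall>r\<ge>0. \<exists>d>0. \<exists>L. L-lipschitz_on (cball r d \<inter> {0..}) f"
    and "\<forall>r\<ge>0. f r > 0"
    and "\<delta> > 0"
    and "\<forall>r\<in>{0..\<delta>}. (f has_real_derivative f' r) (at r within {0..\<delta>})"
    and "continuous_on {0..\<delta>} f'"
    and "\<sigma> > 0" and "f' 0 < - \<sigma>"
    and "classical_solution s u (\<lambda>x t. R (norm x) * f (u x t))"
    and "\<forall>x t. u x t > 0"
    and "bounded (range (\<lambda>(x, t). u x t))"
    and "uniformly_continuous_on UNIV (\<lambda>(x, t). u x t)"
    and "uniform_limit UNIV u (\<lambda>t. 0) at_infinity"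
  shows "\<forall>t.
      (\<forall>x y. norm x = norm y \<longrightarrow> u x t = u y t) \<and>
      (\<forall>x y. norm x < norm y \<longrightarrow> u x t > u y t) \<and>
      (\<forall>e. norm e = 1 \<longrightarrow>
         (\<forall>x. u (x - (2 * (x \<bullet> e)) *\<^sub>R e) t = u x t) \<and>
         strict_antimono_on {0..} (\<lambda>r. u (r *\<^sub>R e) t))"
proof -
  have eq: "frac_heat s u x t = R (norm x) * f (u x t)" for x t
    using assms(13) by (simp add: classical_solution_def)
  \<comment> \<open>Positivity of the right-hand side excludes the default value 0 of a divergent
    integral.\<close>
  have "R (norm x) * f (u x t) \<noteq> 0" for x t
    using assms(5)[rule_format, of "norm x"] assms(7)[rule_format, of "u x t"] assms(14) by (simp add: less_imp_le)
  then interpret decaying_positive s u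
    using assms by unfold_locales (auto simp: eq)
  obtain M where M: "0 < M" "\<And>x t. u x t \<le> M" using upper_bound by blast
  obtain L where L: "L-lipschitz_on {0..M} f" using lipschitz_on_Icc_if_locally[OF assms(6)] by blast
  \<comment> \<open>The minimum of \<open>f\<close> over \<open>{0..M}\<close> serves as the
    positive lower bound \<open>c\<close>.\<close>
  have "\<exists>a\<in>{0..M}. \<forall>b\<in>{0..M}. f a \<le> f b"
    using M(1) by (intro continuous_attains_inf lipschitz_on_continuous_on[OF L]) auto
  then obtain a where a: "a \<in> {0..M}" "\<And>b. b \<in> {0..M} \<Longrightarrow> f a \<le> f b" by blast
  obtain r where r: "0 < r" "\<And>a b. 0 \<le> a \<Longrightarrow> a \<le> b \<Longrightarrow> b \<le> r \<Longrightarrow> f b \<le> f a"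
  proof -
    have "f' 0 < 0" using assms(11,12) by linarith
    then show ?thesis
      using antitone_near_zero[OF assms(8) bspec[OF assms(9)] assms(10)] that by blast
  qed
  interpret moving_planes s u R f "f a" L M r
    by unfold_locales (use assms(3-5,7) M L a r in \<open>simp_all add: eq\<close>)
  show ?thesis
  proof (intro allI conjI impI)
    fix t and x e :: "real ^ 'n" assume e: "norm e = 1"
    have "norm (x - (2 * (x \<bullet> e)) *\<^sub>R e) = norm x"
      using norm_reflect_diff_reflect[OF e, of 0 x 0] by (simp add: reflect_def)
    then show "u (x - (2 * (x \<bullet> e)) *\<^sub>R e) t = u x t" by (rule radially_symmetric)
    show "strict_antimono_on {0..} (\<lambda>r. u (r *\<^sub>R e) t)"
      by (rule monotone_onI) (auto intro!: radially_decreasing simp: e)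
  qed (erule radially_symmetric, erule radially_decreasing)
qed

end
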